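(* The space of $3$-loop Jacobi diagrams of odd degree vanishes. That is, let $\mathcal{A}_{3\text{-loop}}$ be the $\mathbb{Q}$-vector space spanned by $3$-loop Jacobi diagrams subject to the AS and IHX relations, graded by degree, and let $\mathcal{A}_{3\text{-loop}}^{(\mathrm{odd})}$ be its odd degree part, i.e. the subspace spanned by (the classes of) $3$-loop Jacobi diagrams of odd degree. Then $$\mathcal{A}_{3\text{-loop}}^{(\mathrm{odd})} = 0 .$$
   Context: A Jacobi diagram (also called an open Jacobi diagram) is a finite graph (loops and multiple edges allowed) each of whose vertices has valence $1$ or $3$ and whose trivalent vertices are oriented, i.e. a cyclic order of the three half-edges at each trivalent vertex is fixed. Diagrams are considered up to isomorphism of graphs preserving the cyclic orders; univalent vertices are unlabelled. The degree of a Jacobi diagram is half its total number of vertices (univalent and trivalent). A Jacobi diagram is $n$-loop if it is connected and its Euler characteristic is $1-n$, equivalently its first Betti number is $n$. An edge adjacent to a univalent vertex is called a leg. (For a $3$-loop Jacobi diagram with $u$ legs the degree equals $u+2$, so odd degree is equivalent to having an odd number of legs.) The space $\mathcal{A}_{n\text{-loop}}$ of $n$-loop Jacobi diagrams is the $\mathbb{Q}$-vector space spanned by $n$-loop Jacobi diagrams, modulo the following relations, both of which preserve the degree and the number of loops: AS (antisymmetry) relation: if $D'$ is obtained from $D$ by reversing the cyclic order at one trivalent vertex, then $D' = -D$. IHX relation (written "I $=$ H $-$ X"): let $e$ be an edge joining two distinct trivalent vertices, and let $a,b,c,d$ be the four other half-edges at the two ends of $e$. For three Jacobi diagrams which are identical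 except near $e$, where the two end vertices of $e$ carry the half-edges with the following cyclic orders, $$D_1:\ (a,b,e),\ (e,c,d);\qquad D_2:\ (b,c,e),\ (e,a,d);\qquad D_3:\ (c,a,e),\ (e,b,d),$$ one has $D_1+D_2+D_3=0$. (Modulo AS this is the same as I $=$ H $-$ X, where in planar pictures with vertices oriented counterclockwise, $a,b$ are the upper left and right ends, $c,d$ the lower left and right ends, I joins $a,b$ at one vertex and $c,d$ at the other, H joins $a,c$ at one vertex and $b,d$ at the other, and X is H with two of the strands crossed so that it joins $a,d$ at one vertex and $b,c$ at the other.) *)

theory Defs
  imports Complex_Main "HOL-Combinatorics.Permutations" "HOL-Combinatorics.Orbits" "HOL-Library.Poly_Mapping"
begin

section \<open>Jacobi diagrams\<close>

text \<open>
  A graph with loops and multiple edges is encoded by its half-edges. The involution \<open>opp\<close> without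
  fixed points sends a half-edge to the other half of its edge. The permutation \<open>rot\<close> sends a
  half-edge to its successor in the cyclic order at its vertex, so the vertices are the orbits of
  \<open>rot\<close>, and the valence of a vertex is the size of the orbit. Every vertex has valence at least 1,
  so no vertex is lost. Since diagrams are finite and only matter up to isomorphism, natural numbers
  suffice as half-edges.
\<close>

record half_edge_graph =
  half_edges :: "nat set"
  opp :: "nat \<Rightarrow> nat"
  rot :: "nat \<Rightarrow> nat"

definition vertices :: "half_edge_graph \<Rightarrow> nat set set" where
  "vertices D = orbit (rot D) ` half_edges D"

definition edges :: "half_edge_graph \<Rightarrow> nat set set" where
  "edges D = (\<lambda>h. {h, opp D h}) ` half_edges D"

definition jacobi :: "half_edge_graph \<Rightarrow> bool" where
  "jacobi D \<longleftrightarrow>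
     finite (half_edges D) \<and>
     opp D permutes half_edges D \<and>
     (\<forall>h\<in>half_edges D. opp D h \<noteq> h \<and> opp D (opp D h) = h) \<and>
     rot D permutes half_edges D \<and>
     (\<forall>v\<in>vertices D. card v = 1 \<or> card v = 3)"

definition jacobi_iso :: "half_edge_graph \<Rightarrow> half_edge_graph \<Rightarrow> bool" where
  "jacobi_iso D D' \<longleftrightarrow> jacobi D \<and> jacobi D' \<and>
     (\<exists>f. bij_betw f (half_edges D) (half_edges D') \<and>
          (\<forall>h\<in>half_edges D. f (opp D h) = opp D' (f h) \<and> f (rot D h) = rot D' (f h)))"

lemma jacobi_iso_refl: "jacobi D \<Longrightarrow> jacobi_iso D D"
  unfolding jacobi_iso_def by (auto intro!: exI[of _ id])

lemma jacobi_iso_sym: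
  assumes "jacobi_iso D D'"
  shows "jacobi_iso D' D"
proof -
  obtain f where J: "jacobi D" "jacobi D'" and f: "bij_betw f (half_edges D) (half_edges D')"
    and c: "\<And>h. h \<in> half_edges D \<Longrightarrow> f (opp D h) = opp D' (f h) \<and> f (rot D h) = rot D' (f h)"
    using assms unfolding jacobi_iso_def by blast
  let ?g = "inv_into (half_edges D) f"
  have perm: "opp D permutes half_edges D" "rot D permutes half_edges D"
    using J(1) unfolding jacobi_def by blast+
  have "?g (opp D' h) = opp D (?g h) \<and> ?g (rot D' h) = rot D (?g h)" if h: "h \<in> half_edges D'" for h
  proof -
    define k where "k = ?g h"
    have k: "k \<in> half_edges D" and h: "h = f k"
      using f h by (simp_all add: k_def bij_betw_apply[OF bij_betw_inv_into] bij_betw_inv_into_right)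
    have "opp D k \<in> half_edges D" "rot D k \<in> half_edges D"
      using k by (simp_all only: permutes_in_image[OF perm(1)] permutes_in_image[OF perm(2)])
    then have g: "?g (f (opp D k)) = opp D k" "?g (f (rot D k)) = rot D k"
      by (simp_all only: bij_betw_inv_into_left[OF f])
    have "opp D' h = f (opp D k)" "rot D' h = f (rot D k)"
      using c[OF k] h by simp_all
    then show ?thesis
      by (simp only: g k_def[symmetric])
  qed
  then show ?thesis
    using J bij_betw_inv_into[OF f] unfolding jacobi_iso_def by blast
qed

lemma jacobi_iso_trans:
  assumes "jacobi_iso D D'" "jacobi_iso D' D''"
  shows "jacobi_iso D D''"
proof -
  obtain f g where fg: "bij_betw f (half_edges D) (half_edges D')"
      "bij_betw g (half_edges D') (half_edges D'')"
    and f: "\<forall>h\<in>half_edges D. f (opp D h) = opp D' (f h) \<and> f (rot D h) = rot D' (f h)"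
    and g: "\<forall>h\<in>half_edges D'. g (opp D' h) = opp D'' (g h) \<and> g (rot D' h) = rot D'' (g h)"
    using assms unfolding jacobi_iso_def by blast
  have "\<forall>h\<in>half_edges D. (g \<circ> f) (opp D h) = opp D'' ((g \<circ> f) h) \<and>
      (g \<circ> f) (rot D h) = rot D'' ((g \<circ> f) h)"
    using f g fg(1) by (auto simp: bij_betw_def)
  then show ?thesis
    using assms bij_betw_trans[OF fg] unfolding jacobi_iso_def by blast
qed

quotient_type jacobi_diagram = half_edge_graph / partial: jacobi_iso
proof (rule part_equivpI)
  have "jacobi \<lparr>half_edges = {}, opp = id, rot = id\<rparr>"
    by (simp add: jacobi_def vertices_def)
  then show "\<exists>D. jacobi_iso D D"
    using jacobi_iso_refl by blast
  show "symp jacobi_iso"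
    by (rule sympI) (rule jacobi_iso_sym)
  show "transp jacobi_iso"
    by (rule transpI) (rule jacobi_iso_trans)
qed

section \<open>Degree and number of loops\<close>

text \<open>
  The number of vertices is even: it has the same parity as the sum of the valences, which is
  twice the number of edges. So the division in the degree is exact.
\<close>

definition degree :: "half_edge_graph \<Rightarrow> nat" where
  "degree D = card (vertices D) div 2"

definition euler_char :: "half_edge_graph \<Rightarrow> int" where
  "euler_char D = int (card (vertices D)) - int (card (edges D))"

definition adjacent :: "half_edge_graph \<Rightarrow> (nat set \<times> nat set) set" where
  "adjacent D = {(v, w). v \<in> vertices D \<and> w \<in> vertices D \<and> (\<exists>h\<in>v. opp D h \<in> w)}"

definition connected_graph :: "half_edge_graph \<Rightarrow> bool" where
  "connected_graph D \<longleftrightarrow> vertices D \<noteq> {} \<and>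
     (\<forall>v\<in>vertices D. \<forall>w\<in>vertices D. (v, w) \<in> (adjacent D)\<^sup>*)"

definition n_loop :: "nat \<Rightarrow> half_edge_graph \<Rightarrow> bool" where
  "n_loop n D \<longleftrightarrow> jacobi D \<and> connected_graph D \<and> euler_char D = 1 - int n"

section \<open>The AS and IHX relations\<close>

definition cyc :: "half_edge_graph \<Rightarrow> nat \<Rightarrow> nat \<Rightarrow> nat \<Rightarrow> bool" where
  "cyc D x y z \<longleftrightarrow> rot D x = y \<and> rot D y = z \<and> rot D z = x"

definition same_outside :: "nat set \<Rightarrow> half_edge_graph \<Rightarrow> half_edge_graph \<Rightarrow> bool" where
  "same_outside S D D' \<longleftrightarrow> half_edges D' = half_edges D \<and>
     (\<forall>h\<in>half_edges D. opp D' h = opp D h) \<and>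
     (\<forall>h\<in>half_edges D - S. rot D' h = rot D h)"

definition AS_rel :: "half_edge_graph \<Rightarrow> half_edge_graph \<Rightarrow> bool" where
  "AS_rel D D' \<longleftrightarrow>
     (\<exists>x y z. distinct [x, y, z] \<and> {x, y, z} \<subseteq> half_edges D \<and>
        same_outside {x, y, z} D D' \<and> cyc D x y z \<and> cyc D' z y x)"

text \<open>
  The edge in question has the halves \<open>e\<close> and \<open>e'\<close>. The half-edges \<open>a\<close>, \<open>b\<close>, \<open>c\<close>, \<open>d\<close> are distinct,
  but two of them may be halves of the same edge.
\<close>

definition IHX_rel :: "half_edge_graph \<Rightarrow> half_edge_graph \<Rightarrow> half_edge_graph \<Rightarrow> bool" where
  "IHX_rel D1 D2 D3 \<longleftrightarrow>
     (\<exists>a b c d e e'. distinct [a, b, c, d, e, e'] \<and> {a, b, c, d, e, e'} \<subseteq> half_edges D1 \<and>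
        opp D1 e = e' \<and>
        same_outside {a, b, c, d, e, e'} D1 D2 \<and> same_outside {a, b, c, d, e, e'} D1 D3 \<and>
        cyc D1 a b e \<and> cyc D1 e' c d \<and>
        cyc D2 b c e \<and> cyc D2 e' a d \<and>
        cyc D3 c a e \<and> cyc D3 e' b d)"

section \<open>The space of \<open>n\<close>-loop Jacobi diagrams\<close>

definition chain_scale :: "rat \<Rightarrow> ('a \<Rightarrow>\<^sub>0 rat) \<Rightarrow> ('a \<Rightarrow>\<^sub>0 rat)" where
  "chain_scale r x = Poly_Mapping.map ((*) r) x"

lemma lookup_chain_scale [simp]:
  "Poly_Mapping.lookup (chain_scale r x) k = r * Poly_Mapping.lookup x k"
  by (simp add: chain_scale_def map.rep_eq when_def)

global_interpretation chain: vector_space "chain_scale :: rat \<Rightarrow> ('a \<Rightarrow>\<^sub>0 rat) \<Rightarrow> _"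
  by standard (auto intro!: poly_mapping_eqI simp: lookup_add algebra_simps)

definition diagram :: "half_edge_graph \<Rightarrow> (jacobi_diagram \<Rightarrow>\<^sub>0 rat)" where
  "diagram D = Poly_Mapping.single (abs_jacobi_diagram D) 1"

definition loop_chains :: "nat \<Rightarrow> (jacobi_diagram \<Rightarrow>\<^sub>0 rat) set" where
  "loop_chains n = chain.span {diagram D | D. n_loop n D}"

definition odd_loop_chains :: "nat \<Rightarrow> (jacobi_diagram \<Rightarrow>\<^sub>0 rat) set" where
  "odd_loop_chains n = chain.span {diagram D | D. n_loop n D \<and> odd (degree D)}"

definition loop_relators :: "nat \<Rightarrow> (jacobi_diagram \<Rightarrow>\<^sub>0 rat) set" where
  "loop_relators n = chain.span
     ({diagram D' + diagram D | D D'. n_loop n D \<and> n_loop n D' \<and> AS_rel D D'} \<union>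
      {diagram D1 + diagram D2 + diagram D3 | D1 D2 D3.
         n_loop n D1 \<and> n_loop n D2 \<and> n_loop n D3 \<and> IHX_rel D1 D2 D3})"

definition loop_equiv :: "nat \<Rightarrow> ((jacobi_diagram \<Rightarrow>\<^sub>0 rat) \<times> (jacobi_diagram \<Rightarrow>\<^sub>0 rat)) set" where
  "loop_equiv n = {(x, y). x \<in> loop_chains n \<and> y \<in> loop_chains n \<and> x - y \<in> loop_relators n}"

definition loop_space :: "nat \<Rightarrow> (jacobi_diagram \<Rightarrow>\<^sub>0 rat) set set" where
  "loop_space n = loop_chains n // loop_equiv n"

definition loop_class :: "nat \<Rightarrow> (jacobi_diagram \<Rightarrow>\<^sub>0 rat) \<Rightarrow> (jacobi_diagram \<Rightarrow>\<^sub>0 rat) set" where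
  "loop_class n x = loop_equiv n `` {x}"

text \<open>
  By linearity of the quotient map, the subspace spanned by the classes of the odd degree diagrams
  is the image of the span of these diagrams.
\<close>

definition odd_loop_space :: "nat \<Rightarrow> (jacobi_diagram \<Rightarrow>\<^sub>0 rat) set set" where
  "odd_loop_space n = loop_class n ` odd_loop_chains n"

lemma odd_loop_chains_subset: "odd_loop_chains n \<subseteq> loop_chains n"
  unfolding odd_loop_chains_def loop_chains_def by (rule chain.span_mono) blast

lemma odd_loop_space_subset: "odd_loop_space n \<subseteq> loop_space n"
  using odd_loop_chains_subset
  by (auto simp: odd_loop_space_def loop_space_def loop_class_def quotient_def)

lemma zero_in_loop_space: "loop_class n 0 \<in> loop_space n"
  by (auto simp: loop_space_def loop_class_def quotient_def loop_chains_def chain.span_zero)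

lemma equiv_loop_equiv: "equiv (loop_chains n) (loop_equiv n)"
proof (rule equivI)
  show "loop_equiv n \<subseteq> loop_chains n \<times> loop_chains n"
    by (auto simp: loop_equiv_def)
  show "refl_on (loop_chains n) (loop_equiv n)"
    by (auto simp: refl_on_def loop_equiv_def loop_relators_def chain.span_zero)
  show "sym (loop_equiv n)"
  proof (rule symI)
    fix x y assume "(x, y) \<in> loop_equiv n"
    then show "(y, x) \<in> loop_equiv n"
      using chain.span_neg[of "x - y"] unfolding loop_equiv_def loop_relators_def by simp
  qed
  show "trans (loop_equiv n)"
  proof (rule transI)
    fix x y z assume "(x, y) \<in> loop_equiv n" "(y, z) \<in> loop_equiv n"
    then show "(x, z) \<in> loop_equiv n"
      using chain.span_add[of "x - y" _ "y - z"] unfolding loop_equiv_def loop_relators_def by simp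
  qed
qed

end

theory Submission
  imports Defs
begin

text \<open>
  A linear functional \<open>W\<close> that vanishes on the relators is shown to vanish on every 3-loop diagram
  with an odd number of legs. By IHX a circle in a diagram can absorb neighbouring trivalent vertices
  one at a time, so it suffices to consider a circle through all trivalent vertices. Such a diagram
  is a cyclic word in \<open>n\<close> letters for legs and two pairs of letters for the ends of two chords.
  Expanding a tripod with feet on the circle at two of its feet gives a 4T relation, for a leg as
  well as for the end of a chord. Reversing the circle changes the sign, as the length \<open>n + 4\<close> of
  the word is odd.

  If the chords are parallel, 4T makes \<open>W\<close> symmetric under a reversal of the word, so \<open>W\<close> is 0.
  If they cross, let \<open>X i j k l\<close> be the value for the arcs with \<open>i, j, k, l\<close> legs. As parallel
  chords contribute nothing, moving an end of one chord past the other one gives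
  \<open>X i 0 k l = X 0 i k l\<close>. With the leg relation
  \<open>X (i+1) j k l - X i (j+1) k l + X i j (k+1) l - X i j k (l+1) = 0\<close> this acts on the polynomials
  in the arc variables like a transvection, which has no nonzero coinvariants that are
  compatible with the reversal.
\<close>

section \<open>Three-loop diagrams in terms of half-edges\<close>

text \<open>Euler characteristic -2 forces \<open>u + 4\<close> trivalent vertices on a diagram with
  \<open>u\<close> legs: on a circle through all of them, \<open>u\<close> carry legs and the other
  four carry the ends of two chords. Such a diagram is determined by its word up to isomorphism, so
  \<open>W\<close> becomes a function on words. Diagrams are never built from words: each word
  needed is a rearrangement of one that occurs, and an IHX term swaps adjacent letters. For crossed
  chords, regard \<open>X\<close> as a functional on the polynomials of degree \<open>n\<close> in
  \<open>a, b, c, d\<close>, with \<open>X i j k l\<close> its value on the monomial with these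
  exponents. The leg relation says that it kills the multiples of \<open>a - b + c - d\<close>, so
  \<open>b = a + (c - d)\<close>; the chord relation makes it invariant under the transvection
  sending \<open>a\<close> to \<open>a + (c - d)\<close> and fixing \<open>c, d\<close>. Over the
  rationals the differences under this map fill out all multiples of \<open>c - d\<close>. Thus
  \<open>c = d\<close> and \<open>a = b\<close>, and then rotation and reversal both exchange
  \<open>a\<close> and \<open>c\<close>, with opposite signs.\<close>

definition leg_ends :: "half_edge_graph \<Rightarrow> nat set" where
  "leg_ends D = {h \<in> half_edges D. rot D h = h}"

text \<open>The valences 1 and 3 become the single equation that the cube of \<open>rot D\<close> is
  the identity, which is easier to check after a change of the rotation than the sizes of
  orbits.\<close>

definition pre_jacobi :: "half_edge_graph \<Rightarrow> bool" where
  "pre_jacobi D \<longleftrightarrow>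
     finite (half_edges D) \<and> opp D permutes half_edges D \<and> rot D permutes half_edges D \<and>
     (\<forall>h\<in>half_edges D. opp D h \<noteq> h \<and> opp D (opp D h) = h \<and> rot D (rot D (rot D h)) = h)"

text \<open>Connectedness without walks: only the whole is a nonempty set of half-edges stable under
  both permutations. After surgery it suffices to compare stable sets.\<close>

definition closed_connected :: "half_edge_graph \<Rightarrow> bool" where
  "closed_connected D \<longleftrightarrow> half_edges D \<noteq> {} \<and>
     (\<forall>S. S \<subseteq> half_edges D \<longrightarrow> S \<noteq> {} \<longrightarrow> (\<forall>h\<in>S. opp D h \<in> S \<and> rot D h \<in> S) \<longrightarrow> S = half_edges D)"

text \<open>For \<open>u\<close> leg ends and \<open>t\<close> trivalent vertices there are
  \<open>u + 3 t\<close> half-edges, and the Euler characteristic is half of \<open>u - t\<close>.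
  The value -2 gives \<open>t = u + 4\<close>, hence \<open>4 u + 12\<close> half-edges.\<close>

definition good :: "half_edge_graph \<Rightarrow> bool" where
  "good D \<longleftrightarrow> pre_jacobi D \<and> closed_connected D \<and> card (half_edges D) = 4 * card (leg_ends D) + 12"

section \<open>Equivalence of \<open>good\<close> with the graph-theoretic definition of a 3-loop
  diagram\<close>

lemma orbit_cube:
  assumes "f (f (f x)) = x"
  shows "orbit f x = {x, f x, f (f x)}"
proof
  show "orbit f x \<subseteq> {x, f x, f (f x)}"
  proof
    fix y assume "y \<in> orbit f x"
    then show "y \<in> {x, f x, f (f x)}"
      by (induction rule: orbit.induct) (use assms in auto)
  qed
  have "f x \<in> orbit f x" by (rule orbit.base)
  moreover from this have "f (f x) \<in> orbit f x" by (rule orbit.step)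
  moreover from this have "f (f (f x)) \<in> orbit f x" by (rule orbit.step)
  ultimately show "{x, f x, f (f x)} \<subseteq> orbit f x"
    using assms by simp
qed

text \<open>An orbit of size 3 consists of \<open>x\<close>, \<open>f x\<close>,
  \<open>f (f x)\<close>, and by injectivity the cycle can only close at \<open>x\<close>.
  Conversely, if the cube fixes \<open>x\<close>, any coincidence among these three points makes
  \<open>x\<close> a fixed point.\<close>

lemma card_orbit_1_or_3_iff:
  assumes "finite S" "f permutes S" "x \<in> S"
  shows "card (orbit f x) = 1 \<or> card (orbit f x) = 3 \<longleftrightarrow> f (f (f x)) = x"
proof
  assume fff: "f (f (f x)) = x"
  have inj: "f y = f z \<longleftrightarrow> y = z" for y z
    using permutes_inj[OF assms(2)] by (auto dest: injD)
  show "card (orbit f x) = 1 \<or> card (orbit f x) = 3"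
  proof (cases "f x = x")
    case False
    then have "f (f x) \<noteq> f x" "f (f x) \<noteq> x"
      using inj fff by metis+
    with False show ?thesis
      by (auto simp: orbit_cube[of f, OF fff])
  qed (simp add: orbit_cube[of f, OF fff])
next
  assume card: "card (orbit f x) = 1 \<or> card (orbit f x) = 3"
  have inj: "f y = f z \<longleftrightarrow> y = z" for y z
    using permutes_inj[OF assms(2)] by (auto dest: injD)
  have "permutation f"
    using assms by (auto simp: permutation_permutes)
  then have x: "x \<in> orbit f x"
    by (rule permutation_self_in_orbit)
  have f: "f y \<in> orbit f x" if "y \<in> orbit f x" for y
    using that by (rule orbit.step)
  have two: "orbit f x \<subseteq> {x, f x}" if "f (f x) = x"
  proof
    fix y assume "y \<in> orbit f x"
    then show "y \<in> {x, f x}"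
      by (induction rule: orbit.induct) (use that in auto)
  qed
  show "f (f (f x)) = x"
  proof (cases "f x = x")
    case False
    have "card (orbit f x) \<noteq> 1"
      using x f[OF x] False by (metis card_1_singletonE singletonD)
    then have 3: "card (orbit f x) = 3"
      using card by simp
    then have fin: "finite (orbit f x)"
      by (simp add: card_ge_0_finite)
    have ffx: "f (f x) \<noteq> x"
      using card_mono[OF _ two] 3 False by force
    have "{x, f x, f (f x)} = orbit f x"
      using 3 fin ffx False inj[of "f x" x] x f[OF x] f[OF f[OF x]]
      by (intro card_subset_eq) auto
    then have "f (f (f x)) \<in> {x, f x, f (f x)}"
      using f[OF f[OF f[OF x]]] by simp
    with ffx False show ?thesis
      using inj by auto
  qed simp
qed

lemma jacobi_iff_pre_jacobi: "jacobi D \<longleftrightarrow> pre_jacobi D"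
  using card_orbit_1_or_3_iff[of "half_edges D" "rot D"]
  unfolding jacobi_def pre_jacobi_def vertices_def by blast

lemma pre_jacobiD:
  assumes "pre_jacobi D" "h \<in> half_edges D"
  shows "opp D h \<in> half_edges D" "rot D h \<in> half_edges D" "opp D h \<noteq> h"
    "opp D (opp D h) = h" "rot D (rot D (rot D h)) = h"
  using assms unfolding pre_jacobi_def by (auto simp: permutes_in_image)

lemma pre_jacobi_vertex:
  assumes "pre_jacobi D" "h \<in> half_edges D"
  shows "orbit (rot D) h = {h, rot D h, rot D (rot D h)}"
  using orbit_cube pre_jacobiD(5)[OF assms] .

lemma vertex_eq:
  assumes "pre_jacobi D" "v \<in> vertices D" "h \<in> v"
  shows "h \<in> half_edges D" "v = {h, rot D h, rot D (rot D h)}"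
proof -
  obtain k where k: "k \<in> half_edges D" "v = orbit (rot D) k"
    using assms(2) by (auto simp: vertices_def)
  have "h \<in> {k, rot D k, rot D (rot D k)}"
    using assms(3) k pre_jacobi_vertex[OF assms(1) k(1)] by simp
  then consider "h = k" | "h = rot D k" | "h = rot D (rot D k)" by blast
  then have "h \<in> half_edges D \<and> v = {h, rot D h, rot D (rot D h)}"
    using k pre_jacobi_vertex[OF assms(1) k(1)] pre_jacobiD(2)[OF assms(1)] pre_jacobiD(5)[OF assms(1) k(1)]
    by cases (auto simp only: insert_commute)
  then show "h \<in> half_edges D" "v = {h, rot D h, rot D (rot D h)}"
    by simp_all
qed

lemma Union_vertices:
  assumes "pre_jacobi D"
  shows "\<Union> (vertices D) = half_edges D"
proof
  show "\<Union> (vertices D) \<subseteq> half_edges D"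
    using vertex_eq(1)[OF assms] by blast
  show "half_edges D \<subseteq> \<Union> (vertices D)"
    using pre_jacobi_vertex[OF assms] unfolding vertices_def by blast
qed

lemma vertices_disjoint:
  assumes "pre_jacobi D" "v \<in> vertices D" "w \<in> vertices D" "h \<in> v" "h \<in> w"
  shows "v = w"
  using vertex_eq(2)[OF assms(1)] assms by metis

lemma vertexI: 
  assumes "pre_jacobi D" "h \<in> half_edges D"
  shows "{h, rot D h, rot D (rot D h)} \<in> vertices D"
  using assms pre_jacobi_vertex by (auto simp: vertices_def)

text \<open>With a half-edge, a stable set contains its whole vertex and the adjacent vertices, so
  stable sets are unions of connected components.\<close>

lemma connected_graph_iff:
  assumes D: "pre_jacobi D"
  shows "connected_graph D \<longleftrightarrow> closed_connected D"
proof
  assume conn: "connected_graph D"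
  show "closed_connected D"
    unfolding closed_connected_def
  proof (intro conjI allI impI)
    show "half_edges D \<noteq> {}"
      using conn by (auto simp: connected_graph_def vertices_def)
    fix S assume S: "S \<subseteq> half_edges D" "S \<noteq> {}" and cl: "\<forall>h\<in>S. opp D h \<in> S \<and> rot D h \<in> S"
    obtain h where h: "h \<in> S" using S by blast
    define v where "v = {h, rot D h, rot D (rot D h)}"
    have reach: "w \<in> vertices D \<and> w \<subseteq> S" if "(v, w) \<in> (adjacent D)\<^sup>*" for w
      using that
    proof induction
      case base
      show ?case using vertexI[OF D] S h cl by (auto simp: v_def)
    next
      case (step w w')
      then obtain k where k: "k \<in> w" "opp D k \<in> w'" "w' \<in> vertices D"
        by (auto simp: adjacent_def)
      then have "opp D k \<in> S" using step cl by blast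
      then have "w' \<subseteq> S"
        using vertex_eq(2)[OF D k(3,2)] cl by blast
      then show ?case using k by simp
    qed
    show "S = half_edges D"
    proof
      show "half_edges D \<subseteq> S"
      proof
        fix k assume "k \<in> half_edges D"
        then have "(v, {k, rot D k, rot D (rot D k)}) \<in> (adjacent D)\<^sup>*"
          using conn vertexI[OF D] S h by (auto simp: v_def connected_graph_def)
        then show "k \<in> S" using reach by blast
      qed
    qed (rule S)
  qed
next
  assume conn: "closed_connected D"
  show "connected_graph D"
    unfolding connected_graph_def
  proof (intro conjI ballI)
    show "vertices D \<noteq> {}"
      using conn by (auto simp: closed_connected_def vertices_def)
    fix v w assume v: "v \<in> vertices D" and w: "w \<in> vertices D"
    define S where "S = \<Union> {u \<in> vertices D. (v, u) \<in> (adjacent D)\<^sup>*}"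
    have ne: "v \<noteq> {}" "w \<noteq> {}"
      using v w pre_jacobi_vertex[OF D] by (auto simp: vertices_def)
    have "S = half_edges D"
    proof -
      have "S \<subseteq> half_edges D"
        using vertex_eq(1)[OF D] by (auto simp: S_def)
      moreover have "S \<noteq> {}"
        using v ne by (auto simp: S_def)
      moreover have "opp D h \<in> S \<and> rot D h \<in> S" if hS: "h \<in> S" for h
      proof -
        obtain u where u: "u \<in> vertices D" "(v, u) \<in> (adjacent D)\<^sup>*" "h \<in> u"
          using hS unfolding S_def by blast
        have "rot D h \<in> S"
          using u vertex_eq(2)[OF D u(1,3)] unfolding S_def by blast
        moreover have "opp D h \<in> S"
        proof -
          let ?k = "opp D h" let ?u = "{?k, rot D ?k, rot D (rot D ?k)}"
          have "?u \<in> vertices D"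
            using vertexI[OF D] pre_jacobiD(1)[OF D] vertex_eq(1)[OF D u(1,3)] by blast
          moreover from this have "(v, ?u) \<in> (adjacent D)\<^sup>*"
            using u by (intro rtrancl_into_rtrancl[OF u(2)]) (auto simp: adjacent_def)
          ultimately show ?thesis unfolding S_def by blast
        qed
        ultimately show ?thesis by simp
      qed
      ultimately show ?thesis
        using conn unfolding closed_connected_def by blast
    qed
    moreover obtain h where h: "h \<in> w" "h \<in> half_edges D"
      using ne(2) w Union_vertices[OF D] by blast
    ultimately have "h \<in> S" by blast
    then obtain u where "u \<in> vertices D" "(v, u) \<in> (adjacent D)\<^sup>*" "h \<in> u"
      unfolding S_def by blast
    then show "(v, w) \<in> (adjacent D)\<^sup>*"
      using vertices_disjoint[OF D _ w _ h(1)] by blast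
  qed
qed

text \<open>\<open>t\<close> is the number of trivalent vertices. Half-edges are counted once by
  vertices and once by edges; an edge has two halves even if it is a loop.\<close>

lemma card_vertices_edges:
  assumes D: "pre_jacobi D"
  obtains t where "card (vertices D) = card (leg_ends D) + t" 
    "card (half_edges D) = card (leg_ends D) + 3 * t" "card (half_edges D) = 2 * card (edges D)"
proof -
  have fin: "finite (half_edges D)"
    using D by (simp add: pre_jacobi_def)
  then have finV: "finite (vertices D)" by (simp add: vertices_def)
  define V1 where "V1 = {v \<in> vertices D. card v = 1}"
  define V3 where "V3 = {v \<in> vertices D. card v = 3}"
  have V: "vertices D = V1 \<union> V3" "V1 \<inter> V3 = {}"
    using D unfolding jacobi_iff_pre_jacobi[symmetric] by (auto simp: V1_def V3_def jacobi_def)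
  have fin13: "finite V1" "finite V3" using finV V by auto
  have "card (half_edges D) = (\<Sum>v\<in>vertices D. card v)"
    unfolding Union_vertices[OF D, symmetric]
  proof (rule card_Union_disjoint)
    show "pairwise disjnt (vertices D)"
      using vertices_disjoint[OF D] by (auto simp: pairwise_def disjnt_def)
    fix v assume "v \<in> vertices D"
    then show "finite v" using fin Union_vertices[OF D] by (metis Union_upper finite_subset)
  qed
  also have "\<dots> = (\<Sum>v\<in>V1. card v) + (\<Sum>v\<in>V3. card v)"
    unfolding V(1) using fin13 V(2) by (rule sum.union_disjoint)
  also have "\<dots> = card V1 + 3 * card V3"
    by (simp add: V1_def V3_def)
  also have V1: "V1 = (\<lambda>h. {h}) ` leg_ends D"
  proof (intro set_eqI iffI)
    fix v assume v: "v \<in> V1"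
    then obtain h where h: "v = {h}" by (auto simp: V1_def card_1_singleton_iff)
    then show "v \<in> (\<lambda>h. {h}) ` leg_ends D"
      using vertex_eq[OF D, of v h] v by (auto simp: V1_def leg_ends_def)
  next
    fix v assume "v \<in> (\<lambda>h. {h}) ` leg_ends D"
    then obtain h where h: "h \<in> half_edges D" "rot D h = h" "v = {h}"
      by (auto simp: leg_ends_def)
    then show "v \<in> V1"
      using vertexI[OF D h(1)] by (simp add: V1_def)
  qed
  also have "card \<dots> = card (leg_ends D)"
    by (rule card_image) simp
  finally have H: "card (half_edges D) = card (leg_ends D) + 3 * card V3" .
  have "card V1 = card (leg_ends D)"
    unfolding V1 by (rule card_image) simp
  then have "card (vertices D) = card (leg_ends D) + card V3"
    using V fin13 by (simp add: card_Un_disjoint)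
  moreover have "card (half_edges D) = 2 * card (edges D)"
  proof -
    have U: "\<Union> (edges D) = half_edges D"
      using pre_jacobiD[OF D] by (auto simp: edges_def)
    have "card (half_edges D) = (\<Sum>e\<in>edges D. card e)"
      unfolding U[symmetric]
    proof (rule card_Union_disjoint)
      show "pairwise disjnt (edges D)"
      proof -
        have "e = {x, opp D x}" if "e \<in> edges D" "x \<in> e" for e x
          using that pre_jacobiD(4)[OF D] by (fastforce simp: edges_def)
        then show ?thesis
          by (auto simp: pairwise_def disjnt_iff)
      qed
      show "finite e" if "e \<in> edges D" for e
        using that by (auto simp: edges_def)
    qed
    also have "\<dots> = (\<Sum>e\<in>edges D. 2)"
    proof (rule sum.cong)
      fix e assume "e \<in> edges D"
      then obtain h where h: "h \<in> half_edges D" "e = {h, opp D h}"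
        by (auto simp: edges_def)
      then show "card e = 2" using pre_jacobiD(3)[OF D h(1)] by auto
    qed simp
    finally show ?thesis by simp
  qed
  ultimately show ?thesis
    using H by (intro that)
qed

lemma n_loop_3_iff: "n_loop 3 D \<longleftrightarrow> good D"
proof (cases "pre_jacobi D")
  case True
  obtain t where "card (vertices D) = card (leg_ends D) + t" 
    "card (half_edges D) = card (leg_ends D) + 3 * t" "card (half_edges D) = 2 * card (edges D)"
    using card_vertices_edges[OF True] .
  then show ?thesis
    using True by (auto simp: n_loop_def good_def jacobi_iff_pre_jacobi connected_graph_iff euler_char_def)
qed (simp add: n_loop_def good_def jacobi_iff_pre_jacobi)

lemma degree_good:
  assumes "good D"
  shows "degree D = card (leg_ends D) + 2"
proof -
  have D: "pre_jacobi D" using assms by (simp add: good_def)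
  obtain t where "card (vertices D) = card (leg_ends D) + t" 
    "card (half_edges D) = card (leg_ends D) + 3 * t"
    using card_vertices_edges[OF D] .
  moreover from this have "t = card (leg_ends D) + 4"
    using assms by (simp add: good_def)
  ultimately show ?thesis
    by (simp add: degree_def)
qed

section \<open>Weight systems\<close>

lemma pre_jacobi_inj:
  assumes "pre_jacobi D"
  shows "rot D h = rot D k \<longleftrightarrow> h = k" "opp D h = opp D k \<longleftrightarrow> h = k"
  using assms permutes_inj[of "rot D"] permutes_inj[of "opp D"]
  by (auto simp: pre_jacobi_def dest: injD)

lemma pre_jacobi_cube:
  assumes "pre_jacobi D"
  shows "rot D (rot D (rot D h)) = h"
  using assms pre_jacobiD(5)[OF assms] permutes_not_in[of "rot D" "half_edges D" h]
  by (cases "h \<in> half_edges D") (auto simp: pre_jacobi_def)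

lemma pre_jacobi_distinct:
  assumes "pre_jacobi D" "rot D h \<noteq> h"
  shows "rot D (rot D h) \<noteq> h" "rot D (rot D h) \<noteq> rot D h"
  using assms pre_jacobi_cube[OF assms(1)] pre_jacobi_inj[OF assms(1)] by metis+

lemma pre_jacobi_trivalent:
  assumes "pre_jacobi D" "rot D h \<noteq> h"
  shows "h \<in> half_edges D"
  using assms permutes_not_in[of "rot D"] by (auto simp: pre_jacobi_def)

text \<open>The test behind every surgery. Half-edges and leg ends are unchanged, and with them the
  count in \<open>good\<close>; connectedness survives because \<open>conn\<close> makes every set
  that is stable for the new rotation stable for the old one.\<close>

lemma good_rot:
  assumes D: "good D" and K: "K \<subseteq> half_edges D"
    and out: "\<And>h. h \<notin> K \<Longrightarrow> r h = rot D h"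
    and in1: "\<And>h. h \<in> K \<Longrightarrow> rot D h \<in> K" "\<And>h. h \<in> K \<Longrightarrow> r h \<in> K"
    and fix_iff: "\<And>h. h \<in> K \<Longrightarrow> r h = h \<longleftrightarrow> rot D h = h"
    and cube: "\<And>h. h \<in> K \<Longrightarrow> r (r (r h)) = h"
    and conn: "\<And>S h k. h \<in> K \<Longrightarrow> h \<in> S \<Longrightarrow> (\<And>h. h \<in> S \<Longrightarrow> opp D h \<in> S \<and> r h \<in> S) \<Longrightarrow> rot D h \<in> S"
  shows "good (D\<lparr>rot := r\<rparr>) \<and> leg_ends (D\<lparr>rot := r\<rparr>) = leg_ends D"
proof -
  let ?D = "D\<lparr>rot := r\<rparr>" and ?H = "half_edges D"
  have pj: "pre_jacobi D" and cc: "closed_connected D" and card: "card ?H = 4 * card (leg_ends D) + 12"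
    using D by (auto simp: good_def)
  have cube': "r (r (r h)) = h" for h
  proof (cases "h \<in> K")
    case False
    moreover from False have 1: "rot D h \<notin> K"
      using in1(1) pre_jacobi_cube[OF pj, of h] by metis
    moreover from 1 have "rot D (rot D h) \<notin> K"
      using in1(1) pre_jacobi_cube[OF pj, of h] by metis
    ultimately show ?thesis
      using pre_jacobi_cube[OF pj, of h] out by simp
  qed (rule cube)
  have "r permutes ?H"
    unfolding permutes_def
  proof (intro conjI allI impI)
    fix x assume x: "x \<notin> ?H"
    then show "r x = x"
      using K pj out[of x] permutes_not_in[of "rot D" ?H x] by (auto simp: pre_jacobi_def)
  next
    fix y show "\<exists>!x. r x = y"
      using cube' by metis
  qed
  then have pj': "pre_jacobi ?D"
    using pj cube' by (simp add: pre_jacobi_def)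
  have legs: "leg_ends ?D = leg_ends D"
  proof -
    have "r h = h \<longleftrightarrow> rot D h = h" for h
      using fix_iff[of h] out[of h] by (cases "h \<in> K") auto
    then show ?thesis by (simp add: leg_ends_def)
  qed
  have "closed_connected ?D"
    unfolding closed_connected_def
  proof (intro conjI allI impI)
    show "half_edges ?D \<noteq> {}" using cc by (simp add: closed_connected_def)
    fix S assume S: "S \<subseteq> half_edges ?D" "S \<noteq> {}" and cl: "\<forall>h\<in>S. opp ?D h \<in> S \<and> rot ?D h \<in> S"
    have "opp D h \<in> S \<and> rot D h \<in> S" if "h \<in> S" for h
      using that cl conn[of h S] out[of h] by (cases "h \<in> K") auto
    then show "S = half_edges ?D"
      using cc S by (auto simp: closed_connected_def)
  qed
  then show "good ?D \<and> leg_ends ?D = leg_ends D"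
    using pj' card legs by (simp add: good_def)
qed

text \<open>As the cube of the rotation is the identity, applying it twice inverts it; on a union
  \<open>K\<close> of vertices this reverses all cyclic orders.\<close>

definition flip :: "nat set \<Rightarrow> half_edge_graph \<Rightarrow> half_edge_graph" where
  "flip K D = D\<lparr>rot := \<lambda>h. if h \<in> K then rot D (rot D h) else rot D h\<rparr>"

lemma flip_simps [simp]:
  "half_edges (flip K D) = half_edges D" "opp (flip K D) = opp D"
  "rot (flip K D) h = (if h \<in> K then rot D (rot D h) else rot D h)"
  by (simp_all add: flip_def)

lemma good_flip:
  assumes D: "good D" and K: "K \<subseteq> half_edges D" and cl: "\<And>h. h \<in> K \<Longrightarrow> rot D h \<in> K"
  shows "good (flip K D)" "leg_ends (flip K D) = leg_ends D"
proof -
  have pj: "pre_jacobi D" using D by (simp add: good_def)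
  note cube = pre_jacobi_cube[OF pj]
  have *: "rot D (rot D h) = h \<longleftrightarrow> rot D h = h" for h
    using cube[of h] by auto
  let ?r = "\<lambda>h. if h \<in> K then rot D (rot D h) else rot D h"
  have "rot D h \<in> S" if "h \<in> K" "h \<in> S" "\<And>h. h \<in> S \<Longrightarrow> opp D h \<in> S \<and> ?r h \<in> S" for S h
  proof -
    have "?r (?r h) \<in> S" using that by blast
    then show ?thesis using that(1,2) cl[OF that(1)] cl[OF cl[OF that(1)]] cube[of h] by simp
  qed
  note conn = this
  have "good (D\<lparr>rot := ?r\<rparr>) \<and> leg_ends (D\<lparr>rot := ?r\<rparr>) = leg_ends D"
  proof (rule good_rot[OF D K])
    show "?r (?r (?r h)) = h" if "h \<in> K" for h
      using that cl by (simp add: cube)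
    show "?r h = h \<longleftrightarrow> rot D h = h" for h
      using * by simp
    show "rot D h \<in> S" if "h \<in> K" "h \<in> S" "\<And>h. h \<in> S \<Longrightarrow> opp D h \<in> S \<and> ?r h \<in> S" for S h
      using conn that by blast
  qed (simp_all add: cl)
  then show "good (flip K D)" "leg_ends (flip K D) = leg_ends D"
    by (simp_all add: flip_def)
qed

text \<open>The vertices \<open>(a, b, e)\<close> and \<open>(e', c, d)\<close> become
  \<open>(b, c, e)\<close> and \<open>(e', a, d)\<close>, as in the second diagram of
  \<open>IHX_rel\<close>; \<open>ihx3\<close> yields the third one.\<close>

definition ihx2 :: "nat \<Rightarrow> half_edge_graph \<Rightarrow> half_edge_graph" where
  "ihx2 e D = (let e' = opp D e; a = rot D e; b = rot D a; c = rot D e'; d = rot D c in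
     D\<lparr>rot := (rot D)(b := c, c := e, e := b, e' := a, a := d, d := e')\<rparr>)"

definition ihx3 :: "nat \<Rightarrow> half_edge_graph \<Rightarrow> half_edge_graph" where
  "ihx3 e D = (let e' = opp D e; a = rot D e; b = rot D a; c = rot D e'; d = rot D c in
     D\<lparr>rot := (rot D)(c := a, a := e, e := c, e' := b, b := d, d := e')\<rparr>)"

text \<open>The edge joins two different trivalent vertices, as IHX requires: its other half lies
  nowhere at the vertex of \<open>e\<close>.\<close>

definition inner_edge :: "half_edge_graph \<Rightarrow> nat \<Rightarrow> bool" where
  "inner_edge D e \<longleftrightarrow> rot D e \<noteq> e \<and> rot D (opp D e) \<noteq> opp D e \<and>
     opp D e \<noteq> rot D e \<and> opp D e \<noteq> rot D (rot D e)"

lemma inner_edge_distinct: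
  assumes D: "pre_jacobi D" and e: "inner_edge D e"
  defines "e' \<equiv> opp D e"
  shows "distinct [rot D e, rot D (rot D e), rot D e', rot D (rot D e'), e, e']"
    "{rot D e, rot D (rot D e), rot D e', rot D (rot D e'), e, e'} \<subseteq> half_edges D"
proof -
  have eH: "e \<in> half_edges D"
    using pre_jacobi_trivalent[OF D] e by (simp add: inner_edge_def)
  then have e'H: "e' \<in> half_edges D" "e' \<noteq> e"
    using pre_jacobiD[OF D] by (simp_all add: e'_def)
  show "{rot D e, rot D (rot D e), rot D e', rot D (rot D e'), e, e'} \<subseteq> half_edges D"
    using eH e'H pre_jacobiD(2)[OF D] by simp
  have ne: "rot D e \<noteq> e" "rot D e' \<noteq> e'" "e' \<noteq> rot D e" "e' \<noteq> rot D (rot D e)"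
    using e by (simp_all add: inner_edge_def e'_def)
  note cube = pre_jacobi_cube[OF D]
  have *: "x \<noteq> y" if "rot D x \<noteq> rot D y" for x y using that by auto
  have "rot D e' \<noteq> e" "rot D (rot D e') \<noteq> e"
    using ne cube[of e'] by (metis, metis)
  moreover have "rot D (rot D e) \<noteq> rot D e'" "rot D (rot D e) \<noteq> rot D (rot D e')"
      "rot D e \<noteq> rot D e'" "rot D e \<noteq> rot D (rot D e')"
    using ne e'H calculation pre_jacobi_inj(1)[OF D] by metis+
  ultimately show "distinct [rot D e, rot D (rot D e), rot D e', rot D (rot D e'), e, e']"
    using ne e'H pre_jacobi_distinct[OF D ne(1)] pre_jacobi_distinct[OF D ne(2)] by auto
qed

lemma ihx_simps [simp]:
  "half_edges (ihx2 e D) = half_edges D" "opp (ihx2 e D) = opp D"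
  "half_edges (ihx3 e D) = half_edges D" "opp (ihx3 e D) = opp D"
  by (simp_all add: ihx2_def ihx3_def Let_def)

lemma rot_ihx:
  assumes "pre_jacobi D" "inner_edge D e"
    and "e' = opp D e" "a = rot D e" "b = rot D a" "c = rot D e'" "d = rot D c"
  shows "rot (ihx2 e D) b = c" "rot (ihx2 e D) c = e" "rot (ihx2 e D) e = b"
    "rot (ihx2 e D) e' = a" "rot (ihx2 e D) a = d" "rot (ihx2 e D) d = e'"
    "rot (ihx3 e D) c = a" "rot (ihx3 e D) a = e" "rot (ihx3 e D) e = c"
    "rot (ihx3 e D) e' = b" "rot (ihx3 e D) b = d" "rot (ihx3 e D) d = e'"
    "h \<notin> {a, b, c, d, e, e'} \<Longrightarrow> rot (ihx2 e D) h = rot D h"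
    "h \<notin> {a, b, c, d, e, e'} \<Longrightarrow> rot (ihx3 e D) h = rot D h"
proof -
  note * = inner_edge_distinct[OF assms(1,2), folded assms(3), folded assms(4,6), folded assms(5,7)]
  then have dist: "a \<noteq> b" "a \<noteq> c" "a \<noteq> d" "a \<noteq> e" "a \<noteq> e'" "b \<noteq> c" "b \<noteq> d" "b \<noteq> e" "b \<noteq> e'"
      "c \<noteq> d" "c \<noteq> e" "c \<noteq> e'" "d \<noteq> e" "d \<noteq> e'" "e \<noteq> e'"
    by simp_all
  have 2: "ihx2 e D = D\<lparr>rot := (rot D)(b := c, c := e, e := b, e' := a, a := d, d := e')\<rparr>"
    and 3: "ihx3 e D = D\<lparr>rot := (rot D)(c := a, a := e, e := c, e' := b, b := d, d := e')\<rparr>"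
    unfolding ihx2_def ihx3_def Let_def assms(3-7) by (rule refl)+
  show "rot (ihx2 e D) b = c" "rot (ihx2 e D) c = e" "rot (ihx2 e D) e = b"
    "rot (ihx2 e D) e' = a" "rot (ihx2 e D) a = d" "rot (ihx2 e D) d = e'"
    "rot (ihx3 e D) c = a" "rot (ihx3 e D) a = e" "rot (ihx3 e D) e = c"
    "rot (ihx3 e D) e' = b" "rot (ihx3 e D) b = d" "rot (ihx3 e D) d = e'"
    "h \<notin> {a, b, c, d, e, e'} \<Longrightarrow> rot (ihx2 e D) h = rot D h"
    "h \<notin> {a, b, c, d, e, e'} \<Longrightarrow> rot (ihx3 e D) h = rot D h"
    unfolding 2 3 using dist by simp_all
qed

lemma good_ihx:
  assumes D: "good D" and e: "inner_edge D e"
  shows "good (ihx2 e D)" "leg_ends (ihx2 e D) = leg_ends D"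
    "good (ihx3 e D)" "leg_ends (ihx3 e D) = leg_ends D"
proof -
  have pj: "pre_jacobi D" using D by (simp add: good_def)
  define e' a b c d where names: "e' = opp D e" "a = rot D e" "b = rot D a" "c = rot D e'" "d = rot D c"
  let ?K = "{a, b, c, d, e, e'}"
  note * = inner_edge_distinct[OF pj e, folded names(1), folded names(2,4), folded names(3,5)]
  note rots = rot_ihx[OF pj e names]
  have upd: "ihx2 e D = D\<lparr>rot := rot (ihx2 e D)\<rparr>" "ihx3 e D = D\<lparr>rot := rot (ihx3 e D)\<rparr>"
    by (simp_all add: ihx2_def ihx3_def Let_def)
  have eH: "e \<in> half_edges D" using * by simp
  have oe: "opp D e = e'" "opp D e' = e"
    using pre_jacobiD(4)[OF pj eH] by (simp_all add: names)
  have rD: "rot D e = a" "rot D a = b" "rot D b = e" "rot D e' = c" "rot D c = d" "rot D d = e'"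
    using pre_jacobi_cube[OF pj, of e] pre_jacobi_cube[OF pj, of e'] by (simp_all add: names)
  have KH: "?K \<subseteq> half_edges D" using *(2) .
  have dist: "a \<noteq> b" "a \<noteq> c" "a \<noteq> d" "a \<noteq> e" "a \<noteq> e'" "b \<noteq> c" "b \<noteq> d" "b \<noteq> e" "b \<noteq> e'"
      "c \<noteq> d" "c \<noteq> e" "c \<noteq> e'" "d \<noteq> e" "d \<noteq> e'" "e \<noteq> e'"
    using *(1) by simp_all
  \<comment> \<open>A stable set meeting the two vertices contains \<open>e\<close> or
    \<open>e'\<close>, hence both because they are opposite, hence all six half-edges. The rotation
    \<open>r\<close> is left general to serve both IHX terms.\<close>
  have conn: "rot D h \<in> S" if h: "h \<in> ?K" "h \<in> S" and S: "\<And>h. h \<in> S \<Longrightarrow> opp D h \<in> S \<and> r h \<in> S"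
    and r: "r e' \<in> ?K" "r (r e') \<in> ?K" "r (r (r e')) = e'" "r e \<in> ?K" "r (r e) \<in> ?K" "r (r (r e)) = e"
      "?K = {e', r e', r (r e'), e, r e, r (r e)}" for h S r
  proof -
    have rS: "r h \<in> S" "r (r h) \<in> S" using h(2) S by blast+
    have "h = e' \<or> h = r e' \<or> h = r (r e') \<or> h = e \<or> h = r e \<or> h = r (r e)"
      using h(1) unfolding r(7) by blast
    then have "e \<in> S \<or> e' \<in> S"
      using rS h(2) r(3,6) by (elim disjE) simp_all
    then have "e \<in> S" "e' \<in> S" using S oe by metis+
    then have "?K \<subseteq> S" unfolding r(7) by (simp add: S)
    moreover have "rot D h \<in> ?K" using h(1) rD by (elim insertE) simp_all
    ultimately show ?thesis by blast
  qed
  have "good (D\<lparr>rot := rot (ihx2 e D)\<rparr>) \<and> leg_ends (D\<lparr>rot := rot (ihx2 e D)\<rparr>) = leg_ends D"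
  proof (rule good_rot[OF D KH])
    fix S h assume "h \<in> ?K" "h \<in> S" "\<And>h. h \<in> S \<Longrightarrow> opp D h \<in> S \<and> rot (ihx2 e D) h \<in> S"
    then show "rot D h \<in> S" by (rule conn) (auto simp: rots)
  qed (use dist in \<open>auto simp: rots rD\<close>)
  then show "good (ihx2 e D)" "leg_ends (ihx2 e D) = leg_ends D"
    using upd by simp_all
  have "good (D\<lparr>rot := rot (ihx3 e D)\<rparr>) \<and> leg_ends (D\<lparr>rot := rot (ihx3 e D)\<rparr>) = leg_ends D"
  proof (rule good_rot[OF D KH])
    fix S h assume "h \<in> ?K" "h \<in> S" "\<And>h. h \<in> S \<Longrightarrow> opp D h \<in> S \<and> rot (ihx3 e D) h \<in> S"
    then show "rot D h \<in> S" by (rule conn) (auto simp: rots)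
  qed (use dist in \<open>auto simp: rots rD\<close>)
  then show "good (ihx3 e D)" "leg_ends (ihx3 e D) = leg_ends D"
    using upd by simp_all
qed

text \<open>Functionals on the 3-loop space, seen as functions on half-edge graphs; by
  \<open>n_loop_3_iff\<close> the relations imposed are those between 3-loop diagrams.\<close>

locale weight_system =
  fixes W :: "half_edge_graph \<Rightarrow> rat"
  assumes iso: "\<And>D D'. jacobi_iso D D' \<Longrightarrow> W D = W D'"
    and AS: "\<And>D D'. \<lbrakk>good D; good D'; AS_rel D D'\<rbrakk> \<Longrightarrow> W D' = - W D"
    and IHX: "\<And>D1 D2 D3. \<lbrakk>good D1; good D2; good D3; IHX_rel D1 D2 D3\<rbrakk> \<Longrightarrow> W D1 + W D2 + W D3 = 0"
begin

lemma W_ihx: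
  assumes D: "good D" and e: "inner_edge D e"
  shows "W D + W (ihx2 e D) + W (ihx3 e D) = 0"
proof (rule IHX[OF D good_ihx(1,3)[OF assms]])
  have pj: "pre_jacobi D" using D by (simp add: good_def)
  define e' a b c d where names: "e' = opp D e" "a = rot D e" "b = rot D a" "c = rot D e'" "d = rot D c"
  note * = inner_edge_distinct[OF pj e, folded names(1), folded names(2,4), folded names(3,5)]
  note rots = rot_ihx[OF pj e names]
  have rD: "rot D e = a" "rot D a = b" "rot D b = e" "rot D e' = c" "rot D c = d" "rot D d = e'"
    using pre_jacobi_cube[OF pj, of e] pre_jacobi_cube[OF pj, of e'] by (simp_all add: names)
  show "IHX_rel D (ihx2 e D) (ihx3 e D)"
    unfolding IHX_rel_def
    by (rule exI[of _ a], rule exI[of _ b], rule exI[of _ c], rule exI[of _ d], rule exI[of _ e], rule exI[of _ e'])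
      (use * names(1)[symmetric] in \<open>auto simp: rots rD cyc_def same_outside_def\<close>)
qed

lemma W_flip_vertex:
  assumes D: "good D" and x: "rot D x \<noteq> x"
  shows "W (flip {x, rot D x, rot D (rot D x)} D) = - W D"
proof (rule AS[OF D good_flip(1)[OF D]])
  have pj: "pre_jacobi D" using D by (simp add: good_def)
  have xH: "x \<in> half_edges D" using pre_jacobi_trivalent[OF pj x] .
  then show H: "{x, rot D x, rot D (rot D x)} \<subseteq> half_edges D"
    using pre_jacobiD(2)[OF pj] by simp
  note cube = pre_jacobi_cube[OF pj]
  show "rot D h \<in> {x, rot D x, rot D (rot D x)}" if "h \<in> {x, rot D x, rot D (rot D x)}" for h
    using that cube by auto
  show "AS_rel D (flip {x, rot D x, rot D (rot D x)} D)"
    unfolding AS_rel_def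
    by (rule exI[of _ x], rule exI[of _ "rot D x"], rule exI[of _ "rot D (rot D x)"])
      (use H x pre_jacobi_distinct[OF pj x] cube in \<open>auto simp: cyc_def same_outside_def\<close>)
qed

end

section \<open>Circles in diagrams\<close>

text \<open>A path enters a vertex at \<open>x\<close>, leaves it at \<open>rot D x\<close>, and
  \<open>rot D (rot D x)\<close> points off the path. \<open>thirds\<close> collects these last
  half-edges, where legs and chords are attached.\<close>

definition verts :: "half_edge_graph \<Rightarrow> nat list \<Rightarrow> nat list" where
  "verts D xs = concat (map (\<lambda>x. [x, rot D x, rot D (rot D x)]) xs)"

definition thirds :: "half_edge_graph \<Rightarrow> nat list \<Rightarrow> nat list" where
  "thirds D xs = map (\<lambda>x. rot D (rot D x)) xs"

definition linked :: "half_edge_graph \<Rightarrow> nat list \<Rightarrow> bool" where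
  "linked D = successively (\<lambda>x y. opp D (rot D x) = y)"

text \<open>A closed path is given by the half-edges at which it enters the vertices. It has to
  leave each vertex at the next half-edge in the cyclic order.\<close>

definition circle :: "half_edge_graph \<Rightarrow> nat list \<Rightarrow> bool" where
  "circle D xs \<longleftrightarrow> xs \<noteq> [] \<and> distinct (verts D xs) \<and> linked D (xs @ [hd xs])"

lemma verts_simps [simp]:
  "verts D [] = []" "verts D (x # xs) = x # rot D x # rot D (rot D x) # verts D xs"
  "verts D (xs @ ys) = verts D xs @ verts D ys"
  by (simp_all add: verts_def)

lemma thirds_simps [simp]:
  "thirds D [] = []" "thirds D (x # xs) = rot D (rot D x) # thirds D xs"
  "thirds D (xs @ ys) = thirds D xs @ thirds D ys"
  by (simp_all add: thirds_def)

lemma linked_simps [simp]: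
  "linked D []" "linked D [x]" "linked D (x # y # xs) \<longleftrightarrow> opp D (rot D x) = y \<and> linked D (y # xs)"
  by (simp_all add: linked_def)

lemma linked_Cons: "zs \<noteq> [] \<Longrightarrow> linked D (x # zs) \<longleftrightarrow> opp D (rot D x) = hd zs \<and> linked D zs"
  by (cases zs) auto

lemma linked_append:
  "linked D (xs @ x # ys) \<longleftrightarrow> linked D (xs @ [x]) \<and> linked D (x # ys)"
  by (auto simp: linked_def successively_append_iff)

lemma length_thirds [simp]: "length (thirds D xs) = length xs"
  by (simp add: thirds_def)

lemma length_verts [simp]: "length (verts D xs) = 3 * length xs"
  by (induction xs) auto

lemma set_verts: "set (verts D xs) = (\<Union>x\<in>set xs. {x, rot D x, rot D (rot D x)})"
  by (auto simp: verts_def)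

lemma set_thirds_subset: "set (thirds D xs) \<subseteq> set (verts D xs)"
  by (auto simp: set_verts thirds_def)

lemma set_subset_verts: "set xs \<subseteq> set (verts D xs)"
  by (auto simp: set_verts)

lemma rot_in_verts_iff:
  assumes "pre_jacobi D"
  shows "rot D h \<in> set (verts D xs) \<longleftrightarrow> h \<in> set (verts D xs)"
proof -
  have 1: "rot D h \<in> set (verts D xs)" if "h \<in> set (verts D xs)" for h
    using that by (auto simp: set_verts pre_jacobi_cube[OF assms])
  show ?thesis
    using 1[of h] 1[OF 1[of "rot D h"]] pre_jacobi_cube[OF assms, of h] by metis
qed

lemma circle_rotate:
  assumes "circle D (xs @ ys)"
  shows "circle D (ys @ xs)"
proof (cases "xs = [] \<or> ys = []")
  case False
  then obtain x xs' y ys' where "xs = x # xs'" "ys = y # ys'"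
    by (auto simp: neq_Nil_conv)
  then show ?thesis
    using assms linked_append[of D "x # xs'" y "ys' @ [x]"] linked_append[of D "y # ys'" x "xs' @ [y]"]
    by (auto simp: circle_def)
qed (use assms in auto)

lemma verts_cong:
  assumes "\<And>h. h \<in> set (verts D xs) \<Longrightarrow> rot D' h = rot D h"
  shows "verts D' xs = verts D xs" "thirds D' xs = thirds D xs"
  using assms by (induction xs) auto

lemma linked_cong:
  assumes "\<And>h. h \<in> set xs \<Longrightarrow> rot D' h = rot D h" "opp D' = opp D"
  shows "linked D' (xs @ [y]) = linked D (xs @ [y])"
  using assms by (induction xs rule: induct_list012) auto

lemma circle_trivalent:
  assumes "pre_jacobi D" "circle D xs" "h \<in> set (verts D xs)"
  shows "rot D h \<noteq> h" "h \<in> half_edges D"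
proof -
  obtain x where x: "x \<in> set xs" "h \<in> {x, rot D x, rot D (rot D x)}"
    using assms(3) by (auto simp: set_verts)
  obtain us vs where "xs = us @ x # vs"
    using x(1) by (auto simp: in_set_conv_decomp)
  then have "rot D x \<noteq> x"
    using assms(2) by (auto simp: circle_def)
  then show "rot D h \<noteq> h"
    using x(2) pre_jacobi_inj(1)[OF assms(1)] by auto
  then show "h \<in> half_edges D"
    by (rule pre_jacobi_trivalent[OF assms(1)])
qed

text \<open>The first diagram of IHX is the given one. The other two have a circle that passes also
  through the vertex of \<open>e'\<close>; in one of them it takes the wrong turn there, which AS corrects
  at the cost of a sign.\<close>

lemma (in weight_system) expand:
  assumes D: "good D" and circ: "circle D (x # xs)"
    and e': "e' = opp D (rot D (rot D x))" "e' \<notin> set (verts D (x # xs))" "rot D e' \<noteq> e'"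
  obtains D1 D2 y1 y2 where "W D = W D1 - W D2"
    "good D1" "half_edges D1 = half_edges D" "opp D1 = opp D" "leg_ends D1 = leg_ends D"
    "circle D1 (x # y1 # xs)" 
    "thirds D1 (x # y1 # xs) = rot D (rot D e') # rot D e' # thirds D xs"
    "set (verts D1 (x # y1 # xs)) = {e', rot D e', rot D (rot D e')} \<union> set (verts D (x # xs))"
    "good D2" "half_edges D2 = half_edges D" "opp D2 = opp D" "leg_ends D2 = leg_ends D"
    "circle D2 (x # y2 # xs)" 
    "thirds D2 (x # y2 # xs) = rot D e' # rot D (rot D e') # thirds D xs"
    "set (verts D2 (x # y2 # xs)) = {e', rot D e', rot D (rot D e')} \<union> set (verts D (x # xs))"
proof -
  have pj: "pre_jacobi D" using D by (simp add: good_def)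
  define e where e: "e = rot D (rot D x)"
  have e'e: "e' = opp D e" using e' e by simp
  define a where "a = rot D e"
  define b where "b = rot D a"
  define c where "c = rot D e'"
  define d where "d = rot D c"
  note names = e'e a_def b_def c_def d_def
  have ax: "a = x" "b = rot D x"
    by (simp_all add: a_def b_def e pre_jacobi_cube[OF pj])
  have dv: "distinct (verts D (x # xs))"
    using circ by (simp add: circle_def)
  have inner: "inner_edge D e"
    using dv e' pre_jacobi_cube[OF pj, of x] by (auto simp: inner_edge_def e'e[symmetric] e)
  note * = inner_edge_distinct[OF pj inner, folded names(1), folded names(2,4), folded names(3,5)]
  note rots = rot_ihx[OF pj inner names]
  have dist: "a \<noteq> b" "a \<noteq> c" "a \<noteq> d" "a \<noteq> e" "a \<noteq> e'" "b \<noteq> c" "b \<noteq> d" "b \<noteq> e" "b \<noteq> e'"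
      "c \<noteq> d" "c \<noteq> e" "c \<noteq> e'" "d \<noteq> e" "d \<noteq> e'" "e \<noteq> e'"
    using *(1) by simp_all
  let ?K = "{a, b, c, d, e, e'}"
  have K: "?K \<inter> set (verts D xs) = {}"
  proof -
    have "e' \<notin> set (verts D xs)" using e' by simp
    moreover from this have "c \<notin> set (verts D xs)" "d \<notin> set (verts D xs)"
      using rot_in_verts_iff[OF pj] by (simp_all add: c_def d_def)
    ultimately show ?thesis using dv by (simp add: ax e)
  qed
  have oe: "opp D e = e'" "opp D e' = e"
    using *(2) pre_jacobiD(4)[OF pj, of e] e'e by simp_all
  have ob: "opp D b = hd (xs @ [x])" and lnk: "linked D (xs @ [x])"
    using circ by (cases xs; simp add: circle_def ax)+
  \<comment> \<open>In \<open>ihx3\<close> the path enters at \<open>a\<close>, runs along the edge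
    from \<open>e\<close> to \<open>e'\<close> and leaves at the old exit \<open>b\<close>. In
    \<open>ihx2\<close> it should run from \<open>e'\<close> to \<open>e\<close>, but
    \<open>a\<close> is followed by \<open>d\<close> there; flipping the vertex of \<open>e'\<close>
    puts \<open>e'\<close> after \<open>a\<close>.\<close>
  define D2 where "D2 = ihx3 e D"
  define D1' where "D1' = ihx2 e D"
  define D1 where "D1 = flip {e', rot D1' e', rot D1' (rot D1' e')} D1'"
  have D2: "good D2" "leg_ends D2 = leg_ends D" and D1': "good D1'" "leg_ends D1' = leg_ends D"
    using good_ihx[OF D inner] by (simp_all add: D2_def D1'_def)
  have pj1: "pre_jacobi D1'" using D1' by (simp add: good_def)
  note r1 = rots(1-6,13)[folded D1'_def] and r2 = rots(7-12,14)[folded D2_def]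
  have D1_eq: "D1 = flip {e', a, d} D1'"
    by (simp add: D1_def r1)
  have trip: "{e', a, d} \<subseteq> half_edges D1'"
    using *(2) by (simp add: D1'_def)
  have trip_rot: "rot D1' h \<in> {e', a, d}" if "h \<in> {e', a, d}" for h
    using that by (auto simp: r1)
  have D1: "good D1" "leg_ends D1 = leg_ends D"
    using good_flip[OF D1'(1) trip trip_rot] D1'(2) by (simp_all add: D1_eq)
  have W1: "W D1 = - W D1'"
    unfolding D1_def using D1'(1) dist by (intro W_flip_vertex) (simp_all add: r1)
  have R1: "rot D1 b = c" "rot D1 c = e" "rot D1 e = b" "rot D1 a = e'" "rot D1 e' = d" "rot D1 d = a"
      and R1': "\<And>h. h \<notin> ?K \<Longrightarrow> rot D1 h = rot D h"
    using dist by (simp_all add: D1_eq r1)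
  have cg1: "verts D1 xs = verts D xs" "thirds D1 xs = thirds D xs"
    using K by (intro verts_cong R1'; blast)+
  have cg2: "verts D2 xs = verts D xs" "thirds D2 xs = thirds D xs"
    using K by (intro verts_cong r2(7); blast)+
  have xsK: "h \<notin> ?K" if "h \<in> set xs" for h
    using that K set_subset_verts[of xs D] by blast
  have l1: "linked D1 (xs @ [x])"
    using lnk by (subst linked_cong[of xs D1 D]) (use xsK R1' in \<open>auto simp: D1_eq D1'_def\<close>)
  have l2: "linked D2 (xs @ [x])"
    using lnk by (subst linked_cong[of xs D2 D]) (use xsK r2(7) in \<open>auto simp: D2_def\<close>)
  have o1: "opp D1 = opp D" "opp D2 = opp D"
    by (simp_all add: D1_eq D1'_def D2_def)
  have out: "{e', c, d} \<inter> set (verts D xs) = {}" "{a, b, e} \<inter> set (verts D xs) = {}" "distinct (verts D xs)"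
    using K dv by auto
  have sv: "set (verts D (a # xs)) = {a, b, e} \<union> set (verts D xs)"
    by (simp add: ax(1) ax(2)[symmetric], simp add: ax(2) e)
  have sv1: "set (verts D1 (a # e # xs)) = {a, e', d, e, b, c} \<union> set (verts D xs)"
    by (simp add: cg1 R1)
  have sv2: "set (verts D2 (a # e' # xs)) = {a, e', d, e, b, c} \<union> set (verts D xs)"
    by (auto simp: cg2 r2)
  show ?thesis
  proof (rule that[of D1 D2 e e'])
    show "W D = W D1 - W D2"
      using W_ihx[OF D inner] W1 by (simp add: D1'_def D2_def)
    show "circle D1 (x # e # xs)"
    proof -
      have "distinct (verts D1 (a # e # xs))"
        using out dist by (simp add: cg1 R1)
      moreover have "linked D1 (a # e # xs @ [a])"
        using l1 ob unfolding ax(1)[symmetric] by (simp add: linked_Cons[of "xs @ [a]"] R1 oe o1)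
      ultimately show ?thesis by (simp add: circle_def ax(1))
    qed
    show "circle D2 (x # e' # xs)"
    proof -
      have "distinct (verts D2 (a # e' # xs))"
        using out dist by (simp add: cg2 r2)
      moreover have "linked D2 (a # e' # xs @ [a])"
        using l2 ob unfolding ax(1)[symmetric] by (simp add: linked_Cons[of "xs @ [a]"] r2 oe o1)
      ultimately show ?thesis by (simp add: circle_def ax(1))
    qed
    show "thirds D1 (x # e # xs) = rot D (rot D e') # rot D e' # thirds D xs"
      unfolding ax(1)[symmetric] by (simp add: cg1 R1 c_def[symmetric] d_def[symmetric])
    show "thirds D2 (x # e' # xs) = rot D e' # rot D (rot D e') # thirds D xs"
      unfolding ax(1)[symmetric] by (simp add: cg2 r2 c_def[symmetric] d_def[symmetric])
    show "set (verts D1 (x # e # xs)) = {e', rot D e', rot D (rot D e')} \<union> set (verts D (x # xs))"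
      unfolding ax(1)[symmetric] c_def[symmetric] d_def[symmetric] sv1 sv by blast
    show "set (verts D2 (x # e' # xs)) = {e', rot D e', rot D (rot D e')} \<union> set (verts D (x # xs))"
      unfolding ax(1)[symmetric] c_def[symmetric] d_def[symmetric] sv2 sv by blast
  qed (simp_all add: D1 D2 o1, simp_all add: D1_eq D1'_def D2_def)
qed

text \<open>The reverse of an expansion: an IHX exchange at the edge between two consecutive circle
  vertices takes the second one off the circle. It becomes the centre of a tripod with one foot at
  \<open>x\<close>, its other two half-edges being the former third half-edges of both
  vertices.\<close>

lemma contract:
  assumes D: "good D" and circ: "circle D (x # y # ys)"
  obtains T where "good T" "half_edges T = half_edges D" "opp T = opp D" "leg_ends T = leg_ends D"
    "circle T (x # ys)" "thirds T (x # ys) = rot D x # thirds D ys"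
    "opp T (rot D x) = y" "rot T y = rot D (rot D x)" "rot T (rot D (rot D x)) = rot D (rot D y)"
    "y \<notin> set (verts T (x # ys))" 
    "{y, rot D (rot D x), rot D (rot D y)} \<union> set (verts T (x # ys)) = set (verts D (x # y # ys))"
proof -
  have pj: "pre_jacobi D" using D by (simp add: good_def)
  define e where "e = rot D x"
  define e' where "e' = opp D e"
  define a where "a = rot D e"
  define b where "b = rot D a"
  define c where "c = rot D e'"
  define d where "d = rot D c"
  note names = e'_def a_def b_def c_def d_def
  have bx: "b = x" and e'y: "e' = y"
    using circ pre_jacobi_cube[OF pj, of x] by (simp_all add: b_def a_def e_def e'_def circle_def)
  have dv: "distinct (verts D (x # y # ys))"
    using circ by (simp add: circle_def)
  have oy: "opp D (rot D x) = y"
    using circ by (simp add: circle_def)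
  have inner: "inner_edge D e"
    using dv pre_jacobi_cube[OF pj, of x] unfolding inner_edge_def e_def oy by auto
  note * = inner_edge_distinct[OF pj inner, folded names(1), folded names(2,4), folded names(3,5)]
  note rots = rot_ihx[OF pj inner names]
  have dist: "a \<noteq> b" "a \<noteq> c" "a \<noteq> d" "a \<noteq> e" "a \<noteq> e'" "b \<noteq> c" "b \<noteq> d" "b \<noteq> e" "b \<noteq> e'"
      "c \<noteq> d" "c \<noteq> e" "c \<noteq> e'" "d \<noteq> e" "d \<noteq> e'" "e \<noteq> e'"
    using *(1) by simp_all
  let ?K = "{a, b, c, d, e, e'}"
  have K: "?K \<inter> set (verts D ys) = {}" "distinct (verts D ys)"
    using dv unfolding bx e'y c_def d_def a_def e_def by auto
  define T where "T = ihx2 e D"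
  have T: "good T" "leg_ends T = leg_ends D"
    using good_ihx[OF D inner] by (simp_all add: T_def)
  note r = rots(1-6,13)[folded T_def]
  have cg: "verts T ys = verts D ys" "thirds T ys = thirds D ys"
    using K by (intro verts_cong r(7); blast)+
  have ysK: "h \<notin> ?K" if "h \<in> set ys" for h
    using that K set_subset_verts[of ys D] by blast
  have lnk: "opp D c = hd (ys @ [x])" "linked D (ys @ [x])"
    using circ e'y by (cases ys; simp add: circle_def c_def)+
  have l: "linked T (ys @ [x])"
    using lnk by (subst linked_cong[of ys T D]) (use ysK r(7) in \<open>auto simp: T_def\<close>)
  have oT: "opp T = opp D" by (simp add: T_def)
  have az: "rot D (rot D x) = a" "rot D (rot D y) = d" "rot D y = c"
    by (simp_all add: a_def e_def d_def c_def e'y)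
  show ?thesis
  proof (rule that[of T])
    show "circle T (x # ys)"
    proof -
      have "distinct (verts T (b # ys))"
        using K dist by (simp add: cg r)
      moreover have "linked T (b # ys @ [b])"
        using l lnk(1) unfolding bx[symmetric] by (simp add: linked_Cons[of "ys @ [b]"] r oT)
      ultimately show ?thesis by (simp add: circle_def bx)
    qed
    show "thirds T (x # ys) = rot D x # thirds D ys"
      unfolding bx[symmetric] by (simp add: cg r, simp add: bx e_def)
    show "opp T (rot D x) = y"
      using e'y by (simp add: oT e'_def e_def)
    show "y \<notin> set (verts T (x # ys))"
      using K dist e'y unfolding bx[symmetric] by (auto simp: cg r)
    show "{y, rot D (rot D x), rot D (rot D y)} \<union> set (verts T (x # ys)) = set (verts D (x # y # ys))"
    proof -
      have s1: "set (verts D (x # y # ys)) = {b, e, a, e', c, d} \<union> set (verts D ys)"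
        by (simp add: az(1,3) bx e'y e_def d_def)
      have s2: "set (verts T (x # ys)) = {b, c, e} \<union> set (verts D ys)"
        unfolding bx[symmetric] by (simp add: cg r)
      show ?thesis
        unfolding s1 s2 unfolding az(1,2) unfolding e'y[symmetric] by blast
    qed
    show "rot T y = rot D (rot D x)" "rot T (rot D (rot D x)) = rot D (rot D y)"
      unfolding az(1,2) unfolding e'y[symmetric] by (simp_all add: r)
  qed (simp_all add: T, simp_all add: T_def)
qed

section \<open>Diagrams coded by cyclic words\<close>

text \<open>A word lists the half-edges attached to a circle through all trivalent vertices: the letter 0
  stands for a leg, and equal nonzero letters for the two ends of a chord.\<close>

definition full :: "half_edge_graph \<Rightarrow> nat list \<Rightarrow> bool" where
  "full D xs \<longleftrightarrow> half_edges D \<subseteq> set (verts D xs) \<union> leg_ends D"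

text \<open>The equivalence forces a nonzero letter to occur at most twice, and if twice, then at
  the two ends of a chord. A nonzero letter occurring once marks, like 0, a half-edge not joined to
  another one in \<open>ts\<close>.\<close>

definition coloring :: "(nat \<Rightarrow> nat) \<Rightarrow> nat list \<Rightarrow> (nat \<Rightarrow> nat) \<Rightarrow> bool" where
  "coloring f ts L \<longleftrightarrow> (\<forall>h\<in>set ts. \<forall>k\<in>set ts. f h = k \<longleftrightarrow> h \<noteq> k \<and> L h = L k \<and> L h \<noteq> 0)"

definition codes :: "half_edge_graph \<Rightarrow> nat list \<Rightarrow> bool" where
  "codes D w \<longleftrightarrow> good D \<and>
     (\<exists>xs L. circle D xs \<and> full D xs \<and> w = map L (thirds D xs) \<and> coloring (opp D) (thirds D xs) L)"

lemma codesE: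
  assumes "codes D w"
  obtains xs L where "good D" "circle D xs" "full D xs" "w = map L (thirds D xs)"
    "coloring (opp D) (thirds D xs) L"
  using assms by (auto simp: codes_def)

section \<open>How the half-edges around a circle are joined\<close>

lemma circle_opp:
  assumes D: "pre_jacobi D" and circ: "circle D xs" and p: "p < length xs"
  shows "opp D (rot D (xs ! p)) = xs ! (Suc p mod length xs)"
proof -
  have "opp D (rot D ((xs @ [hd xs]) ! p)) = (xs @ [hd xs]) ! Suc p"
    using circ p by (intro successively_nth[of "\<lambda>x y. opp D (rot D x) = y"])
      (auto simp: circle_def linked_def)
  then show ?thesis
    using p hd_conv_nth[of xs] by (cases "Suc p = length xs"; cases "xs = []") (auto simp: nth_append)
qed

lemma circle_opp_closed:
  assumes D: "pre_jacobi D" and circ: "circle D xs" and x: "x \<in> set xs"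
  shows "opp D (rot D x) \<in> set xs" "opp D x \<in> rot D ` set xs"
proof -
  obtain p where p: "p < length xs" "x = xs ! p"
    using x by (auto simp: in_set_conv_nth)
  have "Suc p mod length xs < length xs"
    using p(1) by (cases xs) simp_all
  then show "opp D (rot D x) \<in> set xs"
    using circle_opp[OF D circ p(1)] p(2) by simp
  \<comment> \<open>The cyclic predecessor of \<open>p\<close>, from whose exit the edge arrives at
    \<open>x\<close>.\<close>
  define q where "q = (if p = 0 then length xs - 1 else p - 1)"
  have q: "q < length xs" "Suc q mod length xs = p"
    using p(1) by (auto simp: q_def)
  have "xs ! q \<in> half_edges D"
    using circle_trivalent(2)[OF D circ] set_subset_verts[of xs D] nth_mem[OF q(1)] by blast
  then have "opp D (opp D (rot D (xs ! q))) = rot D (xs ! q)"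
    using pre_jacobiD[OF D] by blast
  then have "opp D x = rot D (xs ! q)"
    using circle_opp[OF D circ q(1)] q(2) p(2) by simp
  then show "opp D x \<in> rot D ` set xs"
    using nth_mem[OF q(1)] by blast
qed

lemma set_verts_split: "set (verts D xs) = set xs \<union> rot D ` set xs \<union> set (thirds D xs)"
  by (induction xs) auto

lemma thirds_disjoint:
  assumes "distinct (verts D xs)" "t \<in> set (thirds D xs)"
  shows "t \<notin> set xs" "t \<notin> rot D ` set xs"
proof -
  have "distinct (verts D xs) \<Longrightarrow> set (thirds D xs) \<inter> (set xs \<union> rot D ` set xs) = {}"
    by (induction xs) (auto simp: set_verts_split)
  then show "t \<notin> set xs" "t \<notin> rot D ` set xs"
    using assms by blast+
qed

text \<open>An edge with two univalent ends would be a whole component with 2 half-edges, while a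
  good diagram has at least 12.\<close>

lemma good_leg_opp:
  assumes D: "good D" and h: "h \<in> leg_ends D"
  shows "opp D h \<in> half_edges D" "opp D h \<notin> leg_ends D"
proof -
  have pj: "pre_jacobi D" and cc: "closed_connected D" and card: "card (half_edges D) = 4 * card (leg_ends D) + 12"
    using D by (auto simp: good_def)
  have hH: "h \<in> half_edges D" "rot D h = h" using h by (auto simp: leg_ends_def)
  show oH: "opp D h \<in> half_edges D" using pre_jacobiD[OF pj hH(1)] by simp
  show "opp D h \<notin> leg_ends D"
  proof
    assume o: "opp D h \<in> leg_ends D"
    let ?S = "{h, opp D h}"
    have "?S = half_edges D"
    proof -
      have "\<forall>k\<in>?S. opp D k \<in> ?S \<and> rot D k \<in> ?S"
        using o hH pre_jacobiD(4)[OF pj hH(1)] by (simp add: leg_ends_def)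
      moreover have "?S \<subseteq> half_edges D" "?S \<noteq> {}"
        using hH oH by simp_all
      ultimately show ?thesis
        using cc unfolding closed_connected_def by simp
    qed
    moreover have "card ?S \<le> 2"
      by (simp add: card_insert_if)
    ultimately show False using card by simp
  qed
qed

text \<open>The edges of the circle use up its entrances and exits, so a half-edge pointing off the
  circle can only meet another such one or a leg end.\<close>

lemma opp_third:
  assumes D: "good D" and circ: "circle D xs" and full: "full D xs"
  shows "t \<in> set (thirds D xs) \<Longrightarrow> opp D t \<in> set (thirds D xs) \<or> opp D t \<in> leg_ends D"
    and "h \<in> leg_ends D \<Longrightarrow> opp D h \<in> set (thirds D xs)"
proof -
  have pj: "pre_jacobi D" using D by (simp add: good_def)
  have dist: "distinct (verts D xs)" using circ by (simp add: circle_def)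
  have key: "opp D h \<in> set (thirds D xs)"
    if h: "h \<in> half_edges D" "h \<notin> set xs" "h \<notin> rot D ` set xs" "opp D h \<in> set (verts D xs)" for h
  proof -
    have oo: "opp D (opp D h) = h"
      using pre_jacobiD[OF pj h(1)] by simp
    have "opp D h \<notin> set xs"
      using circle_opp_closed(2)[OF pj circ, of "opp D h"] oo h by auto
    moreover have "opp D h \<notin> rot D ` set xs"
      using circle_opp_closed(1)[OF pj circ] oo h by auto
    ultimately show ?thesis
      using h(4) by (auto simp: set_verts_split)
  qed
  {
    assume t: "t \<in> set (thirds D xs)"
    then have tH: "t \<in> half_edges D"
      using set_thirds_subset[of D xs] circle_trivalent(2)[OF pj circ] by blast
    then have "opp D t \<in> set (verts D xs) \<or> opp D t \<in> leg_ends D"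
      using full pre_jacobiD(1)[OF pj] by (auto simp: full_def)
    then show "opp D t \<in> set (thirds D xs) \<or> opp D t \<in> leg_ends D"
      using key[OF tH thirds_disjoint[OF dist t]] by blast
  next
    assume h: "h \<in> leg_ends D"
    then have "h \<notin> set (verts D xs)" "h \<in> half_edges D"
      using circle_trivalent(1)[OF pj circ] by (auto simp: leg_ends_def)
    moreover have "opp D h \<in> set (verts D xs)"
      using good_leg_opp[OF D h] full by (auto simp: full_def)
    ultimately show "opp D h \<in> set (thirds D xs)"
      using key[of h] by (simp add: set_verts_split)
  }
qed

lemma card_full:
  assumes D: "good D" and circ: "circle D xs" and full: "full D xs"
  shows "card (half_edges D) = 3 * length xs + card (leg_ends D)" "length xs = card (leg_ends D) + 4"
proof -
  have pj: "pre_jacobi D" using D by (simp add: good_def)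
  have eq: "half_edges D = set (verts D xs) \<union> leg_ends D"
    using full circle_trivalent(2)[OF pj circ] by (auto simp: full_def leg_ends_def)
  have "set (verts D xs) \<inter> leg_ends D = {}"
    using circle_trivalent(1)[OF pj circ] by (auto simp: leg_ends_def)
  moreover have "finite (leg_ends D)"
    using pj by (simp add: pre_jacobi_def leg_ends_def)
  moreover have "card (set (verts D xs)) = 3 * length xs"
    using circ distinct_card[of "verts D xs"] by (simp add: circle_def)
  ultimately show 1: "card (half_edges D) = 3 * length xs + card (leg_ends D)"
    unfolding eq by (simp add: card_Un_disjoint)
  then show "length xs = card (leg_ends D) + 4"
    using D by (simp add: good_def)
qed

lemma coloring_nth:
  assumes "coloring f ts L" "distinct ts" "p < length ts" "q < length ts"
  shows "f (ts ! p) = ts ! q \<longleftrightarrow> p \<noteq> q \<and> map L ts ! p = map L ts ! q \<and> map L ts ! p \<noteq> 0"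
proof -
  have "ts ! p \<in> set ts" "ts ! q \<in> set ts" using assms by simp_all
  then have "f (ts ! p) = ts ! q \<longleftrightarrow> ts ! p \<noteq> ts ! q \<and> L (ts ! p) = L (ts ! q) \<and> L (ts ! p) \<noteq> 0"
    using assms(1) unfolding coloring_def by blast
  then show ?thesis
    using assms(2-4) by (simp add: nth_eq_iff_index_eq)
qed

lemma circle_distinct:
  assumes "circle D xs"
  shows "distinct xs" "distinct (thirds D xs)"
proof -
  have "distinct (verts D xs) \<Longrightarrow> distinct xs \<and> distinct (thirds D xs)"
    using set_thirds_subset[of D] set_subset_verts[of _ D] by (induction xs) auto
  then show "distinct xs" "distinct (thirds D xs)"
    using assms by (auto simp: circle_def)
qed

text \<open>Walking along both circles in parallel matches their vertices. Equal letters tell that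
  the same pairs of third half-edges are joined, and every remaining one ends in a leg, so nothing
  is left undetermined.\<close>

lemma codes_iso:
  assumes "codes D w" "codes D' w"
  shows "jacobi_iso D D'"
proof -
  obtain xs L where D: "good D" "circle D xs" "full D xs" "w = map L (thirds D xs)"
    "coloring (opp D) (thirds D xs) L"
    using assms(1) by (rule codesE)
  obtain xs' L' where D': "good D'" "circle D' xs'" "full D' xs'" "w = map L' (thirds D' xs')"
    "coloring (opp D') (thirds D' xs') L'"
    using assms(2) by (rule codesE)
  have pj: "pre_jacobi D" "pre_jacobi D'" using D D' by (simp_all add: good_def)
  define N where "N = length w"
  have N: "length xs = N" "length xs' = N"
    using arg_cong[OF D(4), of length] arg_cong[OF D'(4), of length] by (simp_all add: N_def)
  note cube = pre_jacobi_cube[OF pj(1)] and cube' = pre_jacobi_cube[OF pj(2)]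
  let ?r = "rot D" and ?r' = "rot D'"
  define g where "g x = the (map_of (zip xs xs') x)" for x
  have g: "g (xs ! p) = xs' ! p" if "p < N" for p
    using that N circle_distinct(1)[OF D(2)] by (simp add: g_def map_of_zip_nth)
  have nthD: "\<exists>p<N. x = xs ! p" if "x \<in> set xs" for x
    using that N(1) by (auto simp: in_set_conv_nth)
  have g_mem: "g x \<in> set xs'" if x: "x \<in> set xs" for x
  proof -
    obtain p where "p < N" "x = xs ! p" using nthD[OF x] by blast
    then show ?thesis using g N(2) by simp
  qed
  have g_surj: "\<exists>x\<in>set xs. y = g x" if y: "y \<in> set xs'" for y
  proof -
    obtain p where "p < N" "y = xs' ! p" using y N(2) unfolding in_set_conv_nth by blast
    then show ?thesis using g[of p] N(1) by (intro bexI[of _ "xs ! p"]) simp_all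
  qed
  have g_link: "opp D' (?r' (g x)) = g (opp D (?r x))" if x: "x \<in> set xs" for x
  proof -
    obtain p where p: "p < N" "x = xs ! p" using nthD[OF x] by blast
    have "Suc p mod N < N" using p(1) by (cases N) simp_all
    then show ?thesis
      using circle_opp[OF pj(1) D(2), of p] circle_opp[OF pj(2) D'(2), of p] p N g by simp
  qed
  have xH: "x \<in> half_edges D" "?r x \<in> half_edges D" "?r (?r x) \<in> half_edges D"
      "?r (?r x) \<in> set (thirds D xs)" "x \<in> set (verts D xs)" "?r x \<in> set (verts D xs)" 
      "?r (?r x) \<in> set (verts D xs)" if "x \<in> set xs" for x
    using that circle_trivalent(2)[OF pj(1) D(2)] by (auto simp: set_verts thirds_def)
  have xH': "x \<in> half_edges D'" "?r' x \<in> half_edges D'" "?r' (?r' x) \<in> half_edges D'"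
      "?r' (?r' x) \<in> set (thirds D' xs')"  if "x \<in> set xs'" for x
    using that circle_trivalent(2)[OF pj(2) D'(2)] by (auto simp: set_verts thirds_def)
  have chord: "opp D (?r (?r x)) = ?r (?r y) \<longleftrightarrow> opp D' (?r' (?r' (g x))) = ?r' (?r' (g y))"
    if xy: "x \<in> set xs" "y \<in> set xs" for x y
  proof -
    obtain p q where p: "p < N" "x = xs ! p" "q < N" "y = xs ! q" 
      using nthD[OF xy(1)] nthD[OF xy(2)] by blast
    have "thirds D xs ! i = ?r (?r (xs ! i))" "thirds D' xs' ! i = ?r' (?r' (xs' ! i))" if "i < N" for i
      using that N by (simp_all add: thirds_def)
    then show ?thesis
      using coloring_nth[OF D(5) circle_distinct(2)[OF D(2)], of p q, folded D(4)]
        coloring_nth[OF D'(5) circle_distinct(2)[OF D'(2)], of p q, folded D'(4)] p N g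
      by simp
  qed
  have dist: "distinct (verts D xs)" using D(2) by (simp add: circle_def)
  \<comment> \<open>The entrance of the vertex of \<open>h\<close> is recovered by rotating on:
    twice from an exit, once from a third half-edge.\<close>
  define f0 where "f0 h = (if h \<in> set xs then g h else if ?r (?r h) \<in> set xs then ?r' (g (?r (?r h)))
    else ?r' (?r' (g (?r h))))" for h
  \<comment> \<open>Off the circle there are only leg ends, which follow their partners.\<close>
  define f where "f h = (if h \<in> set (verts D xs) then f0 h else opp D' (f0 (opp D h)))" for h
  have f0: "f0 x = g x" "f0 (?r x) = ?r' (g x)" "f0 (?r (?r x)) = ?r' (?r' (g x))" if x: "x \<in> set xs" for x
  proof -
    have *: "?r (?r y) \<notin> set xs" if "y \<in> set xs" for y
      using thirds_disjoint(1)[OF dist xH(4)[OF that]] .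
    have "?r x \<notin> set xs"
      using thirds_disjoint(2)[OF dist xH(4)[OF x]] by auto
    then show "f0 x = g x" "f0 (?r x) = ?r' (g x)" "f0 (?r (?r x)) = ?r' (?r' (g x))"
      using x *[OF x] by (simp_all add: f0_def cube)
  qed
  have f: "f x = g x" "f (?r x) = ?r' (g x)" "f (?r (?r x)) = ?r' (?r' (g x))" if "x \<in> set xs" for x
    using f0[OF that] xH[OF that] by (simp_all add: f_def)
  have third_cases: "(\<exists>y\<in>set xs. opp D (?r (?r x)) = ?r (?r y)) \<or> opp D (?r (?r x)) \<in> leg_ends D"
    if "x \<in> set xs" for x
    using opp_third(1)[OF D(1-3) xH(4)[OF that]] by (auto simp: thirds_def)
  have third_cases': "(\<exists>y\<in>set xs. opp D' (?r' (?r' (g x))) = ?r' (?r' (g y))) \<or>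
      opp D' (?r' (?r' (g x))) \<in> leg_ends D'" if "x \<in> set xs" for x
    using opp_third(1)[OF D'(1-3) xH'(4)[OF g_mem[OF that]]] by (auto simp: thirds_def dest!: g_surj)
  have legs_disj: "h \<notin> set (verts D xs)" if "h \<in> leg_ends D" for h
    using that circle_trivalent(1)[OF pj(1) D(2)] by (auto simp: leg_ends_def)
  have fo: "f (opp D (?r (?r x))) = opp D' (?r' (?r' (g x)))" if x: "x \<in> set xs" for x
    using third_cases[OF x]
  proof
    assume "\<exists>y\<in>set xs. opp D (?r (?r x)) = ?r (?r y)"
    then obtain y where y: "y \<in> set xs" "opp D (?r (?r x)) = ?r (?r y)" by blast
    then have "opp D' (?r' (?r' (g x))) = ?r' (?r' (g y))"
      using chord[OF x y(1)] by simp
    then show ?thesis using y f(3)[OF y(1)] by simp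
  next
    assume "opp D (?r (?r x)) \<in> leg_ends D"
    then show ?thesis
      using legs_disj f0(3)[OF x] pre_jacobiD(4)[OF pj(1) xH(3)[OF x]] by (simp add: f_def)
  qed
  have fo_legs: "?r' (opp D' (?r' (?r' (g x)))) = opp D' (?r' (?r' (g x)))"
    if x: "x \<in> set xs" and lg: "opp D (?r (?r x)) \<in> leg_ends D" for x
    using third_cases'[OF x]
  proof
    assume "\<exists>y\<in>set xs. opp D' (?r' (?r' (g x))) = ?r' (?r' (g y))"
    then obtain y where y: "y \<in> set xs" "opp D' (?r' (?r' (g x))) = ?r' (?r' (g y))"
      by blast
    then have "opp D (?r (?r x)) = ?r (?r y)"
      using chord[OF x y(1)] by simp
    then show ?thesis
      using legs_disj[OF lg] xH(7)[OF y(1)] by simp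
  qed (simp add: leg_ends_def)
  have cases: "\<exists>x\<in>set xs. h = x \<or> h = ?r x \<or> h = ?r (?r x) \<or> 
      (h \<in> leg_ends D \<and> h = opp D (?r (?r x)))" if "h \<in> half_edges D" for h
  proof (cases "h \<in> set (verts D xs)")
    case True
    then show ?thesis by (auto simp: set_verts)
  next
    case False
    then have h: "h \<in> leg_ends D" using that D(3) by (auto simp: full_def)
    then obtain x where "x \<in> set xs" "opp D h = ?r (?r x)"
      using opp_third(2)[OF D(1-3)] by (auto simp: thirds_def)
    then show ?thesis using h pre_jacobiD(4)[OF pj(1) that] by (intro bexI[of _ x]) simp_all
  qed
  have comm: "f (opp D h) = opp D' (f h) \<and> f (rot D h) = rot D' (f h)" if h: "h \<in> half_edges D" for h
  proof -
    obtain x where x: "x \<in> set xs" and "h = x \<or> h = ?r x \<or> h = ?r (?r x) \<or> 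
      (h \<in> leg_ends D \<and> h = opp D (?r (?r x)))"
      using cases[OF h] by blast
    then consider "h = x" | "h = ?r x" | "h = ?r (?r x)" | "h \<in> leg_ends D" "h = opp D (?r (?r x))" by blast
    then show ?thesis
    proof cases
      case 1
      obtain y where y: "y \<in> set xs" "opp D x = ?r y"
        using circle_opp_closed(2)[OF pj(1) D(2) x] by blast
      then have "opp D (?r y) = x" 
        using pre_jacobiD(4)[OF pj(1) xH(1)[OF x]] by simp
      then have "opp D' (g x) = ?r' (g y)"
        using g_link[OF y(1)] pre_jacobiD(4)[OF pj(2) xH'(2)[OF g_mem[OF y(1)]]] by simp
      then show ?thesis
        using y f[OF x] f[OF y(1)] by (simp add: 1)
    next
      case 2
      then show ?thesis
        using g_link[OF x] f[OF x] f(1)[OF circle_opp_closed(1)[OF pj(1) D(2) x]] by simp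
    next
      case 3
      then show ?thesis using fo[OF x] f[OF x] cube cube' by simp
    next
      case 4
      then have "rot D h = h" by (simp add: leg_ends_def)
      moreover have "opp D h = ?r (?r x)"
        using 4(2) pre_jacobiD(4)[OF pj(1) xH(3)[OF x]] by simp
      moreover have "f h = opp D' (?r' (?r' (g x)))"
        using fo[OF x] 4(2) by simp
      ultimately show ?thesis
        using fo_legs[OF x] 4 f(3)[OF x] pre_jacobiD(4)[OF pj(2) xH'(3)[OF g_mem[OF x]]] by simp
    qed
  qed
  \<comment> \<open>Only surjectivity is checked directly; injectivity follows from equal finite
    cardinalities, which the common length of the circles determines.\<close>
  have cardH: "card (half_edges D) = card (half_edges D')"
    using card_full[OF D(1-3)] card_full[OF D'(1-3)] N by simp
  have img: "f ` half_edges D = half_edges D'"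
  proof
    show "f ` half_edges D \<subseteq> half_edges D'"
    proof (intro image_subsetI)
      fix h assume "h \<in> half_edges D"
      then obtain x where x: "x \<in> set xs" "h = x \<or> h = ?r x \<or> h = ?r (?r x) \<or> h = opp D (?r (?r x))"
        using cases by blast
      from x(2) show "f h \<in> half_edges D'"
        using f[OF x(1)] fo[OF x(1)] xH'(1-3)[OF g_mem[OF x(1)]]
          pre_jacobiD(1)[OF pj(2) xH'(3)[OF g_mem[OF x(1)]]]
        by (elim disjE) simp_all
    qed
    show "half_edges D' \<subseteq> f ` half_edges D"
    proof
      fix k assume k: "k \<in> half_edges D'"
      show "k \<in> f ` half_edges D"
      proof (cases "k \<in> set (verts D' xs')")
        case True
        then obtain y where y: "y \<in> set xs'" "k \<in> {y, ?r' y, ?r' (?r' y)}"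
          by (auto simp: set_verts)
        then obtain x where x: "x \<in> set xs" "y = g x"
          using g_surj by blast
        have "k = f x \<or> k = f (?r x) \<or> k = f (?r (?r x))"
          using y(2) f[OF x(1)] x(2) by simp
        then show ?thesis
          using xH(1-3)[OF x(1)] by blast
      next
        case False
        then have "k \<in> leg_ends D'" using k D'(3) by (auto simp: full_def)
        then obtain y where y: "y \<in> set xs'" "opp D' k = ?r' (?r' y)"
          using opp_third(2)[OF D'(1-3)] by (auto simp: thirds_def)
        then obtain x where x: "x \<in> set xs" "opp D' k = ?r' (?r' (g x))"
          using g_surj by blast
        then have "k = f (opp D (?r (?r x)))"
          using fo[OF x(1)] pre_jacobiD(4)[OF pj(2) k] by simp
        then show ?thesis
          using pre_jacobiD(1)[OF pj(1) xH(3)[OF x(1)]] by blast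
      qed
    qed
  qed
  have "finite (half_edges D)" using pj by (simp add: pre_jacobi_def)
  then have "inj_on f (half_edges D)"
    using img cardH by (intro eq_card_imp_inj_on) auto
  then have "bij_betw f (half_edges D) (half_edges D')"
    using img by (simp add: bij_betw_def)
  then show ?thesis
    using comm pj by (auto simp: jacobi_iso_def jacobi_iff_pre_jacobi)
qed

lemma coloring_cong: "coloring f ts L \<Longrightarrow> set ts' = set ts \<Longrightarrow> coloring f ts' L"
  by (simp add: coloring_def)

lemma codes_rotate:
  assumes "codes D (u @ v)"
  shows "codes D (v @ u)"
proof -
  obtain xs L where D: "good D" "circle D xs" "full D xs" "u @ v = map L (thirds D xs)"
    "coloring (opp D) (thirds D xs) L"
    using assms by (rule codesE)
  define ys zs where "ys = take (length u) xs" and "zs = drop (length u) xs"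
  have xs: "xs = ys @ zs" by (simp add: ys_def zs_def)
  have "length u \<le> length xs"
    using arg_cong[OF D(4), of length] by simp
  then have "length (map L (thirds D ys)) = length u" by (simp add: ys_def)
  moreover have "map L (thirds D ys) @ map L (thirds D zs) = u @ v"
    using D(4) by (simp add: xs)
  ultimately have uv: "u = map L (thirds D ys)" "v = map L (thirds D zs)"
    using append_eq_append_conv[of "map L (thirds D ys)" u] by auto
  show ?thesis
    unfolding codes_def
  proof (intro conjI exI)
    show "circle D (zs @ ys)" using D(2) circle_rotate by (simp add: xs)
    show "full D (zs @ ys)" using D(3) by (auto simp: xs full_def)
    show "v @ u = map L (thirds D (zs @ ys))" by (simp add: uv)
    show "coloring (opp D) (thirds D (zs @ ys)) L"
      using D(5) by (rule coloring_cong) (auto simp: xs)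
  qed (rule D(1))
qed

lemma full_cong:
  assumes "full D xs" "half_edges D' = half_edges D" "leg_ends D' = leg_ends D"
    "set (verts D' xs') = set (verts D xs)"
  shows "full D' xs'"
  using assms by (simp add: full_def)

context weight_system
begin

text \<open>Contracting the first two circle vertices to a tripod and expanding it at the same foot
  gives the two orders of their letters. \<open>T\<close> is returned with all its data so that it
  can also be expanded at another foot.\<close>

lemma tripod:
  assumes "codes D (z # c # w)"
  obtains T x ys tz tc y L D1 D2 where
    "good T" "circle T (x # ys)" 
    "half_edges T \<subseteq> {y, tz, tc} \<union> set (verts T (x # ys)) \<union> leg_ends T"
    "opp T (rot T (rot T x)) = y" "y \<notin> set (verts T (x # ys))"
    "rot T y = tz" "rot T tz = tc" "tz \<noteq> y"
    "z # c # w = map L (tz # tc # thirds T ys)" "coloring (opp T) (tz # tc # thirds T ys) L"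
    "codes D1 (c # z # w)" "codes D2 (z # c # w)" "W T = W D1 - W D2"
proof -
  obtain xs L where D: "good D" "circle D xs" "full D xs" "z # c # w = map L (thirds D xs)"
    "coloring (opp D) (thirds D xs) L"
    using assms by (rule codesE)
  obtain x y ys where xs: "xs = x # y # ys"
    using D(4) by (cases xs; cases "tl xs") auto
  have pj: "pre_jacobi D" using D by (simp add: good_def)
  let ?tz = "rot D (rot D x)" and ?tc = "rot D (rot D y)"
  obtain T where T: "good T" "half_edges T = half_edges D" "opp T = opp D" "leg_ends T = leg_ends D"
    "circle T (x # ys)" "thirds T (x # ys) = rot D x # thirds D ys"
    "opp T (rot D x) = y" "rot T y = ?tz" "rot T ?tz = ?tc"
    "y \<notin> set (verts T (x # ys))" 
    "{y, ?tz, ?tc} \<union> set (verts T (x # ys)) = set (verts D (x # y # ys))"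
    using contract[OF D(1) D(2)[unfolded xs]] .
  have Te: "rot T (rot T x) = rot D x" "thirds T ys = thirds D ys" "opp T (rot T (rot T x)) = y"
    using T(6,7) by simp_all
  have ne: "?tz \<noteq> y"
    using D(2) by (auto simp: circle_def xs)
  have rTy: "rot T y \<noteq> y" using ne T(8) by simp
  obtain D1 D2 y1 y2 where E: "W T = W D1 - W D2"
    "good D1" "half_edges D1 = half_edges T" "opp D1 = opp T" "leg_ends D1 = leg_ends T"
    "circle D1 (x # y1 # ys)" 
    "thirds D1 (x # y1 # ys) = rot T (rot T y) # rot T y # thirds T ys"
    "set (verts D1 (x # y1 # ys)) = {y, rot T y, rot T (rot T y)} \<union> set (verts T (x # ys))"
    "good D2" "half_edges D2 = half_edges T" "opp D2 = opp T" "leg_ends D2 = leg_ends T"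
    "circle D2 (x # y2 # ys)" 
    "thirds D2 (x # y2 # ys) = rot T y # rot T (rot T y) # thirds T ys"
    "set (verts D2 (x # y2 # ys)) = {y, rot T y, rot T (rot T y)} \<union> set (verts T (x # ys))"
    using expand[OF T(1,5) Te(3)[symmetric] T(10) rTy] .
  show ?thesis
  proof (rule that[of T x ys y ?tz ?tc L D1 D2])
    show "half_edges T \<subseteq> {y, ?tz, ?tc} \<union> set (verts T (x # ys)) \<union> leg_ends T"
      using D(3) unfolding T(2,4,11) xs full_def .
    show "z # c # w = map L (?tz # ?tc # thirds T ys)"
      using D(4) by (simp add: xs Te)
    show col: "coloring (opp T) (?tz # ?tc # thirds T ys) L"
      using D(5) by (simp add: xs Te T(3))
    show "codes D1 (c # z # w)"
      unfolding codes_def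
    proof (intro conjI exI)
      show "full D1 (x # y1 # ys)"
        using D(3) by (rule full_cong) (use E(3,5,8) T(2,4,8,9,11) xs in simp_all)
      show "coloring (opp D1) (thirds D1 (x # y1 # ys)) L"
        unfolding E(4) using col by (rule coloring_cong) (simp only: E(7) T(8,9) list.set insert_commute)
      show "c # z # w = map L (thirds D1 (x # y1 # ys))"
        unfolding E(7) using D(4) T(8,9) by (simp add: xs Te)
    qed (rule E)+
    show "codes D2 (z # c # w)"
      unfolding codes_def
    proof (intro conjI exI)
      show "full D2 (x # y2 # ys)"
        using D(3) by (rule full_cong) (use E(10,12,15) T(2,4,8,9,11) xs in simp_all)
      show "coloring (opp D2) (thirds D2 (x # y2 # ys)) L"
        unfolding E(11) using col by (rule coloring_cong) (simp only: E(14) T(8,9))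
      show "z # c # w = map L (thirds D2 (x # y2 # ys))"
        unfolding E(14) using D(4) T(8,9) by (simp add: xs Te)
    qed (rule E)+
  qed (use T Te ne E(1) in simp_all)
qed

text \<open>The two sides of the 4T relation are the expansions of the same tripod \<open>T\<close> at two of its
  three feet.\<close>

lemma four_term:
  assumes "codes D (z # c # u @ c # v)" "c \<noteq> 0"
  obtains D1 D2 D3 D4 where "codes D1 (c # z # u @ c # v)" "codes D2 (z # c # u @ c # v)"
    "codes D3 (z # c # v @ c # u)" "codes D4 (c # z # v @ c # u)" "W D1 - W D2 = W D3 - W D4"
proof -
  obtain T x ys tz tc y L D1 D2 where T: "good T" "circle T (x # ys)" 
    "half_edges T \<subseteq> {y, tz, tc} \<union> set (verts T (x # ys)) \<union> leg_ends T"
    "opp T (rot T (rot T x)) = y" "y \<notin> set (verts T (x # ys))"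
    "rot T y = tz" "rot T tz = tc" "tz \<noteq> y"
    "z # c # u @ c # v = map L (tz # tc # thirds T ys)" "coloring (opp T) (tz # tc # thirds T ys) L"
    and D12: "codes D1 (c # z # u @ c # v)" "codes D2 (z # c # u @ c # v)" "W T = W D1 - W D2"
    using tripod[OF assms(1)] .
  have pj: "pre_jacobi T" using T by (simp add: good_def)
  have Lz: "z = L tz" "c = L tc" and "u @ c # v = map L (thirds T ys)"
    using T(9) unfolding list.map list.inject by blast+
  then obtain ysu xf ysv where ys: "ys = ysu @ xf # ysv"
    and uv: "u = map L (thirds T ysu)" "c = L (rot T (rot T xf))" "v = map L (thirds T ysv)"
    unfolding thirds_def map_map append_eq_map_conv Cons_eq_map_conv by auto
  define tf where "tf = rot T (rot T xf)"
  define e where "e = rot T (rot T x)"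
  define tus tvs where "tus = thirds T ysu" and "tvs = thirds T ysv"
  have thirds_ys: "thirds T ys = tus @ tf # tvs" by (simp add: ys tf_def tus_def tvs_def)
  have ty: "rot T tc = y"
    using T(6,7) pre_jacobi_cube[OF pj, of y] by simp
  have out: "tz \<notin> set (verts T (x # ys))" "tc \<notin> set (verts T (x # ys))"
    using T(5-7) rot_in_verts_iff[OF pj] by metis+
  have tcne: "rot T tc \<noteq> tc" "tc \<noteq> y" "tc \<noteq> tz"
    using T(6-8) ty pre_jacobi_inj(1)[OF pj] by metis+
  have dt: "distinct (thirds T (x # ys))"
    using circle_distinct[OF T(2)] by simp
  have tsub: "set (thirds T (x # ys)) \<subseteq> set (verts T (x # ys))"
    by (rule set_thirds_subset)
  have eq: "set (thirds T (x # ys)) = insert e (insert tf (set tus \<union> set tvs))"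
    using thirds_ys by (auto simp: e_def)
  have tcf: "opp T tc = tf"
    using T(10) Lz(2) uv(2) assms(2) out(2) tsub eq unfolding coloring_def thirds_ys by (auto simp: tf_def[symmetric])
  have tcH: "tc \<in> half_edges T"
    using pre_jacobi_trivalent[OF pj tcne(1)] .
  have tfc: "opp T tf = tc"
    using tcf pre_jacobiD(4)[OF pj tcH] by simp
  have eH: "e \<in> half_edges T"
    using circle_trivalent(2)[OF pj T(2)] tsub eq by blast
  have ey: "opp T e = y" "opp T y = e"
    using T(4) pre_jacobiD(4)[OF pj eH] by (simp_all add: e_def)
  \<comment> \<open>The circle of \<open>T\<close> is cut open at \<open>xf\<close>, which carries
    the other end of the chord \<open>c\<close>, so that the expansion takes place at that
    foot.\<close>
  have circ: "circle T (xf # ysv @ x # ysu)"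
    using circle_rotate[of T "x # ysu" "xf # ysv"] T(2) by (simp add: ys)
  have vset: "set (verts T (xf # ysv @ x # ysu)) = set (verts T (x # ys))"
    by (auto simp: ys)
  obtain D3 D4 y1 y2 where E: "W T = W D3 - W D4"
    "good D3" "half_edges D3 = half_edges T" "opp D3 = opp T" "leg_ends D3 = leg_ends T"
    "circle D3 (xf # y1 # ysv @ x # ysu)" 
    "thirds D3 (xf # y1 # ysv @ x # ysu) = rot T (rot T tc) # rot T tc # thirds T (ysv @ x # ysu)"
    "set (verts D3 (xf # y1 # ysv @ x # ysu)) = {tc, rot T tc, rot T (rot T tc)} \<union> set (verts T (xf # ysv @ x # ysu))"
    "good D4" "half_edges D4 = half_edges T" "opp D4 = opp T" "leg_ends D4 = leg_ends T"
    "circle D4 (xf # y2 # ysv @ x # ysu)" 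
    "thirds D4 (xf # y2 # ysv @ x # ysu) = rot T tc # rot T (rot T tc) # thirds T (ysv @ x # ysu)"
    "set (verts D4 (xf # y2 # ysv @ x # ysu)) = {tc, rot T tc, rot T (rot T tc)} \<union> set (verts T (xf # ysv @ x # ysu))"
    using expand[OF T(1) circ tfc[symmetric, unfolded tf_def] out(2)[folded vset] tcne(1)] .
  note E = E[unfolded ty T(6)]
  have th: "thirds T (ysv @ x # ysu) = tvs @ e # tus"
    by (simp add: tvs_def tus_def e_def)
  \<comment> \<open>In the new expansions the chord starting at the former centre runs from
    \<open>y\<close> to \<open>e\<close>, so its letter passes to this pair from \<open>tc\<close>
    and \<open>tf\<close>.\<close>
  define L' where "L' = L(y := c, e := c)"
  have notin: "y \<notin> insert tz (set tus \<union> set tvs)" "e \<notin> insert tz (set tus \<union> set tvs)" "e \<noteq> y"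
    using T(5,8) tsub out(1) eq dt thirds_ys unfolding e_def by auto
  have old: "opp T h = k \<longleftrightarrow> h \<noteq> k \<and> L h = L k \<and> L h \<noteq> 0"
    if "h \<in> {tz, tc, tf} \<union> set tus \<union> set tvs" "k \<in> {tz, tc, tf} \<union> set tus \<union> set tvs" for h k
  proof -
    have "{tz, tc, tf} \<union> set tus \<union> set tvs = set (tz # tc # thirds T ys)"
      by (auto simp: thirds_ys)
    then show ?thesis
      using T(10) that unfolding coloring_def by blast
  qed
  have Lne: "L h \<noteq> c" if "h \<in> insert tz (set tus \<union> set tvs)" for h
  proof
    assume "L h = c"
    have ne: "h \<noteq> tc" "h \<noteq> tf"
      using that out tcne(3) tsub eq dt thirds_ys by auto
    then have "opp T tc = h"
      using old[of tc h] that \<open>L h = c\<close> Lz(2) assms(2) by simp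
    then show False using tcf ne by simp
  qed
  have opp_ne: "opp T h \<noteq> y" "opp T h \<noteq> e" if "h \<in> insert tz (set tus \<union> set tvs)" for h
    using that notin ey pre_jacobi_inj(2)[OF pj] by metis+
  have col: "coloring (opp T) (tz # y # tvs @ e # tus) L'"
    unfolding coloring_def
  proof (intro ballI)
    let ?S = "insert tz (set tus \<union> set tvs)"
    have L'_old: "L' h = L h" if "h \<in> ?S" for h
      using that notin unfolding L'_def by (metis fun_upd_other)
    have L'_new: "L' y = c" "L' e = c" by (simp_all add: L'_def)
    fix h k assume "h \<in> set (tz # y # tvs @ e # tus)" "k \<in> set (tz # y # tvs @ e # tus)"
    then consider "h \<in> ?S" "k \<in> ?S" | "h \<in> ?S" "k = y \<or> k = e" | "h = y \<or> h = e" "k \<in> ?S"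
      | "h = y \<or> h = e" "k = y \<or> k = e"
      by auto
    then show "opp T h = k \<longleftrightarrow> h \<noteq> k \<and> L' h = L' k \<and> L' h \<noteq> 0"
    proof cases
      case 1
      then show ?thesis using old[of h k] L'_old by auto
    next
      case 2
      then show ?thesis using opp_ne[OF 2(1)] Lne[OF 2(1)] L'_old[OF 2(1)] L'_new by auto
    next
      case 3
      have "k \<noteq> y" "k \<noteq> e" using notin 3(2) by blast+
      then show ?thesis using 3(1) Lne[OF 3(2)] L'_old[OF 3(2)] L'_new ey by auto
    next
      case 4
      then show ?thesis using L'_new ey notin(3) assms(2) by auto
    qed
  qed
  have w: "map L' (tvs @ e # tus) = v @ c # u" "L' tz = z" "L' y = c"
    using notin uv Lz by (auto simp: L'_def tus_def tvs_def)
  have full: "half_edges T \<subseteq> {tc, y, tz} \<union> set (verts T (x # ys)) \<union> leg_ends T"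
    using T(3) by blast
  show ?thesis
  proof (rule that[OF D12(1,2)])
    show "codes D3 (z # c # v @ c # u)"
      unfolding codes_def
    proof (intro conjI exI)
      show "full D3 (xf # y1 # ysv @ x # ysu)"
        using full unfolding full_def E(3,5,8) vset .
      show "coloring (opp D3) (thirds D3 (xf # y1 # ysv @ x # ysu)) L'"
        using col unfolding E(4,7) th .
      show "z # c # v @ c # u = map L' (thirds D3 (xf # y1 # ysv @ x # ysu))"
        unfolding E(7) th list.map w by simp
    qed (rule E)+
    show "codes D4 (c # z # v @ c # u)"
      unfolding codes_def
    proof (intro conjI exI)
      show "full D4 (xf # y2 # ysv @ x # ysu)"
        using full unfolding full_def E(10,12,15) vset .
      show "coloring (opp D4) (thirds D4 (xf # y2 # ysv @ x # ysu)) L'"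
        using coloring_cong[OF col, of "y # tz # tvs @ e # tus"] unfolding E(11,14) th by auto
      show "c # z # v @ c # u = map L' (thirds D4 (xf # y2 # ysv @ x # ysu))"
        unfolding E(14) th list.map w by simp
    qed (rule E)+
    show "W D1 - W D2 = W D3 - W D4"
      using D12(3) E(1) by simp
  qed
qed

end

section \<open>Reversal of circles, and \<open>W\<close> as a function of words\<close>

lemma distinct_verts_trivalent:
  assumes "pre_jacobi D" "distinct (verts D xs)" "h \<in> set (verts D xs)"
  shows "rot D h \<noteq> h" "h \<in> half_edges D"
proof -
  have "distinct (verts D xs) \<Longrightarrow> x \<in> set xs \<Longrightarrow> rot D x \<noteq> x" for x
    by (induction xs) auto
  then show "rot D h \<noteq> h"
    using assms pre_jacobi_inj(1)[OF assms(1)] by (auto simp: set_verts)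
  then show "h \<in> half_edges D"
    by (rule pre_jacobi_trivalent[OF assms(1)])
qed

context weight_system
begin

text \<open>Flips at different vertices do not interfere, so AS contributes one sign per
  vertex.\<close>

lemma W_flip_verts:
  assumes "good D" "distinct (verts D xs)"
  shows "W (flip (set (verts D xs)) D) = (-1) ^ length xs * W D"
  using assms(2)
proof (induction xs)
  case Nil
  then show ?case by (simp add: flip_def)
next
  case (Cons x xs)
  have pj: "pre_jacobi D" using assms by (simp add: good_def)
  let ?K = "set (verts D xs)"
  define D' where "D' = flip ?K D"
  have dist: "distinct (verts D xs)" using Cons.prems by simp
  have "good D'"
    unfolding D'_def
    using distinct_verts_trivalent(2)[OF pj dist] rot_in_verts_iff[OF pj]
    by (intro good_flip[OF assms(1)]) auto
  have out: "x \<notin> ?K" "rot D x \<notin> ?K" "rot D (rot D x) \<notin> ?K" and x: "rot D x \<noteq> x"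
    using Cons.prems by auto
  have "flip (set (verts D (x # xs))) D = flip {x, rot D' x, rot D' (rot D' x)} D'"
    using out pre_jacobi_cube[OF pj, of x] rot_in_verts_iff[OF pj] unfolding flip_def D'_def by (auto simp: fun_eq_iff)
  moreover have "W (flip {x, rot D' x, rot D' (rot D' x)} D') = - W D'"
    using \<open>good D'\<close> out x by (intro W_flip_vertex) (simp_all add: D'_def)
  ultimately show ?case
    using Cons.IH[OF dist] by (simp add: D'_def)
qed

text \<open>Traversed backwards, with the old exits as entrances, a circle takes the wrong turn at
  every vertex. Flipping all of them repairs this at the cost of one sign each.\<close>

lemma codes_rev:
  assumes "codes D w"
  obtains D' where "codes D' (rev w)" "W D' = (-1) ^ length w * W D"
proof -
  obtain xs L where D: "good D" "circle D xs" "full D xs" "w = map L (thirds D xs)"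
    "coloring (opp D) (thirds D xs) L"
    using assms by (rule codesE)
  have pj: "pre_jacobi D" using D by (simp add: good_def)
  have dist: "distinct (verts D xs)" "xs \<noteq> []" using D(2) by (simp_all add: circle_def)
  note cube = pre_jacobi_cube[OF pj]
  let ?K = "set (verts D xs)"
  define D' where "D' = flip ?K D"
  have D': "good D'" "leg_ends D' = leg_ends D"
    unfolding D'_def
    using distinct_verts_trivalent(2)[OF pj dist(1)] rot_in_verts_iff[OF pj]
    by (auto intro!: good_flip[OF D(1)])
  have xK: "x \<in> ?K" "rot D x \<in> ?K" "rot D (rot D x) \<in> ?K" if "x \<in> set xs" for x
    using that by (auto simp: set_verts)
  have r': "rot D' (rot D x) = x" "rot D' x = rot D (rot D x)" if "x \<in> set xs" for x
    using xK[OF that] cube by (simp_all add: D'_def)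
  define ys where "ys = rev (map (rot D) xs)"
  have vset: "set (verts D' ys) = set (verts D xs)"
    using r' by (auto simp: set_verts ys_def)
  have thirds: "thirds D' ys = rev (thirds D xs)"
    using r' by (simp add: thirds_def ys_def rev_map)
  have "circle D' ys"
    unfolding circle_def
  proof (intro conjI)
    show "ys \<noteq> []" using dist by (simp add: ys_def)
    have "card (set (verts D' ys)) = length (verts D' ys)"
      unfolding vset using distinct_card[OF dist(1)] by (simp add: ys_def)
    then show "distinct (verts D' ys)" by (rule card_distinct)
    obtain us l where xs: "xs = us @ [l]"
      using dist(2) by (cases xs rule: rev_cases) auto
    have "circle D (l # us)"
      using circle_rotate[of D us "[l]"] D(2) by (simp add: xs)
    then have "successively (\<lambda>x y. opp D (rot D x) = y) (l # xs)"
      by (simp add: circle_def linked_def xs)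
    then have "successively (\<lambda>a b. opp D (rot D' (rot D b)) = rot D a) (l # xs)"
    proof (rule successively_mono)
      fix a b assume "a \<in> set (l # xs)" "b \<in> set (l # xs)" and ab: "opp D (rot D a) = b"
      then have "a \<in> set xs" "b \<in> set xs" by (auto simp: xs)
      moreover from this have "opp D b = rot D a"
        using ab pre_jacobiD(4)[OF pj, of "rot D a"] distinct_verts_trivalent(2)[OF pj dist(1) xK(2)] by auto
      ultimately show "opp D (rot D' (rot D b)) = rot D a"
        using r'(1) by simp
    qed
    then have "linked D' (rev (map (rot D) (l # xs)))"
      unfolding linked_def successively_rev successively_map by (simp add: D'_def)
    then show "linked D' (ys @ [hd ys])"
      by (simp add: ys_def xs)
  qed
  moreover have "full D' ys"
    using D(3) by (rule full_cong) (simp_all add: D' vset, simp add: D'_def)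
  moreover have "coloring (opp D') (thirds D' ys) L"
    using coloring_cong[OF D(5), of "rev (thirds D xs)"] unfolding thirds by (simp add: D'_def)
  moreover have "rev w = map L (thirds D' ys)"
    by (simp add: thirds D(4) rev_map)
  ultimately have "codes D' (rev w)"
    using D' unfolding codes_def by blast
  moreover have "W D' = (-1) ^ length w * W D"
    using W_flip_verts[OF D(1) dist(1)] D(4) by (simp add: D'_def)
  ultimately show ?thesis by (rule that)
qed

text \<open>For a word that codes some diagram, the choice does not matter by
  \<open>codes_iso\<close>. Other words get an arbitrary value, which explains the existence
  hypotheses below.\<close>

definition V :: "nat list \<Rightarrow> rat" where
  "V w = W (SOME D. codes D w)"

lemma V_eq:
  assumes "codes D w"
  shows "V w = W D"
proof -
  have "codes (SOME D. codes D w) w" using assms by (rule someI)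
  then show ?thesis
    unfolding V_def using iso codes_iso assms by blast
qed

text \<open>Both words code exactly the same diagrams, so even the chosen diagram is the
  same.\<close>

lemma V_rotate: "V (u @ v) = V (v @ u)"
proof -
  have "(\<lambda>D. codes D (u @ v)) = (\<lambda>D. codes D (v @ u))"
    using codes_rotate by blast
  then show ?thesis by (simp add: V_def)
qed

lemma V_rev:
  assumes "\<exists>D. codes D w"
  shows "V (rev w) = (-1) ^ length w * V w"
proof -
  obtain D where D: "codes D w" using assms by blast
  then obtain D' where "codes D' (rev w)" "W D' = (-1) ^ length w * W D"
    by (rule codes_rev)
  then show ?thesis using D by (simp add: V_eq)
qed

lemma V_four_term:
  assumes "\<exists>D. codes D (z # c # u @ c # v)" "c \<noteq> 0"
  shows "V (c # z # u @ c # v) - V (z # c # u @ c # v) = V (z # c # v @ c # u) - V (c # z # v @ c # u)"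
proof -
  obtain D where "codes D (z # c # u @ c # v)" using assms(1) by blast
  then obtain D1 D2 D3 D4 where "codes D1 (c # z # u @ c # v)" "codes D2 (z # c # u @ c # v)"
    "codes D3 (z # c # v @ c # u)" "codes D4 (c # z # v @ c # u)" "W D1 - W D2 = W D3 - W D4"
    using four_term assms(2) by blast
  then show ?thesis by (simp add: V_eq)
qed

text \<open>One of the two expansions of the tripod formed from \<open>a\<close> and
  \<open>b\<close> codes the swapped word.\<close>

lemma codes_swap:
  assumes "\<exists>D. codes D (u @ a # b # v)"
  shows "\<exists>D. codes D (u @ b # a # v)"
proof -
  obtain D where "codes D (a # b # v @ u)"
    using assms codes_rotate[of _ u "a # b # v"] by auto
  then obtain D1 where "codes D1 (b # a # v @ u)"
    using tripod by metis
  then show ?thesis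
    using codes_rotate[of D1 "b # a # v" u] by auto
qed

text \<open>Adjacent swaps reach every rearrangement; the prefix \<open>p\<close> holds the letters
  already in place.\<close>

lemma codes_mset:
  assumes "\<exists>D. codes D (p @ xs)" "mset xs = mset ys"
  shows "\<exists>D. codes D (p @ ys)"
  using assms
proof (induction ys arbitrary: p xs)
  case Nil
  then show ?case by simp
next
  case (Cons y ys)
  have move: "\<exists>D. codes D (p @ y # l @ r)" if "\<exists>D. codes D (p @ l @ y # r)" for p l r
    using that
  proof (induction l arbitrary: r rule: rev_induct)
    case (snoc a l)
    then have "\<exists>D. codes D ((p @ l) @ y # a # r)"
      using codes_swap[of "p @ l" a y r] by simp
    then show ?case using snoc.IH[of "a # r"] by simp
  qed simp
  have "y \<in> set xs"
    using Cons.prems(2) by (metis list.set_intros(1) set_mset_mset)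
  then obtain l r where xs: "xs = l @ y # r"
    by (meson split_list)
  then have "\<exists>D. codes D ((p @ [y]) @ l @ r)"
    using move Cons.prems(1) by simp
  moreover have "mset (l @ r) = mset ys"
    using Cons.prems(2) by (simp add: xs)
  ultimately show ?case
    using Cons.IH[of "p @ [y]" "l @ r"] by simp
qed

end

text \<open>The differences \<open>Y i j k l = X i j (k+1) l - X i j k (l+1)\<close> vanish by induction on
  \<open>i + j\<close>: by the induction hypothesis they depend only on \<open>i + j\<close>, and their sum
  over \<open>i + j = m\<close> telescopes to \<open>X 0 (m+1) k l - X (m+1) 0 k l\<close>.\<close>

lemma four_parameter_vanish:
  fixes X :: "nat \<Rightarrow> nat \<Rightarrow> nat \<Rightarrow> nat \<Rightarrow> rat"
  assumes R: "\<And>i j k l. Suc (i + j + k + l) = n \<Longrightarrow> X (Suc i) j k l - X i (Suc j) k l + X i j (Suc k) l - X i j k (Suc l) = 0"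
    and T: "\<And>i k l. i + k + l = n \<Longrightarrow> X i 0 k l = X 0 i k l"
    and S: "\<And>i j k l. i + j + k + l = n \<Longrightarrow> X i j k l = X k l i j"
    and A: "\<And>i j k l. i + j + k + l = n \<Longrightarrow> X i j k l = - X l k j i"
    and n: "i + j + k + l = n"
  shows "X i j k l = 0"
proof -
  define Y where "Y i j k l = X i j (Suc k) l - X i j k (Suc l)" for i j k l
  have XY: "X i (Suc j) k l = X (Suc i) j k l + Y i j k l" if "Suc (i + j + k + l) = n" for i j k l
    using R[OF that] by (simp add: Y_def)
  have Y0: "Y i j k l = 0" if "i + j = m" "Suc (m + k + l) = n" for i j k l m
    using that
  proof (induction m arbitrary: i j k l)
    case 0
    then have "X 0 1 k l = X 1 0 k l + Y 0 0 k l"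
      using XY[of 0 0 k l] by simp
    then show ?case
      using T[of 1 k l] 0 by simp
  next
    case (Suc m)
    \<comment> \<open>The difference of the leg relations with \<open>k\<close> and with
      \<open>l\<close> raised by one; their \<open>Y\<close> terms belong to the sum
      \<open>m\<close> and vanish by induction.\<close>
    have shift: "Y i (Suc j) k l = Y (Suc i) j k l" if "i + j = m" for i j
      using XY[of i j "Suc k" l] XY[of i j k "Suc l"] Suc.IH[of i j "Suc k" l] Suc.IH[of i j k "Suc l"] that Suc.prems(2)
      by (simp add: Y_def)
    have const: "Y (Suc m - j) j k l = Y (Suc m) 0 k l" if "j \<le> Suc m" for j
      using that
    proof (induction j)
      case (Suc j)
      then have "Suc m - j = Suc (m - j)" by simp
      then show ?case using Suc shift[of "m - j" j] by simp
    qed simp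
    have "X (Suc (Suc m) - s) s k l = X (Suc (Suc m)) 0 k l + of_nat s * Y (Suc m) 0 k l" if "s \<le> Suc (Suc m)" for s
      using that
    proof (induction s)
      case (Suc s)
      have "Suc (Suc m) - s = Suc (Suc m - s)" using Suc by simp
      then show ?case
        using Suc XY[of "Suc m - s" s k l] const[of s] Suc.prems Suc_leD \<open>Suc (Suc m + k + l) = n\<close>
        by (simp add: algebra_simps)
    qed simp
    \<comment> \<open>At \<open>s = m + 2\<close> all these legs have passed from the first arc to
      the second, and \<open>T\<close> identifies the two extreme values. Dividing by
      \<open>m + 2\<close> is possible over the rationals.\<close>
    from this[of "Suc (Suc m)"] have "of_nat (Suc (Suc m)) * Y (Suc m) 0 k l = 0"
      using T[of "Suc (Suc m)" k l] Suc.prems(2) by simp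
    then have "Y (Suc m) 0 k l = 0" by (simp only: mult_eq_0_iff of_nat_eq_0_iff) simp
    then show ?case
      using const[of j] Suc.prems(1) by (metis add_diff_cancel_right' le_add2)
  qed
  have shift: "X i 0 k l = X i 0 (k + l) 0" if "i + k + l = n" for i k l
    using that
  proof (induction l arbitrary: k)
    case (Suc l)
    then show ?case
      using Y0[of i 0 i k l] Suc.IH[of "Suc k"] by (simp add: Y_def)
  qed simp
  \<comment> \<open>Reversal, rotation, the chord relation \<open>T\<close> and \<open>shift\<close>
    lead back to the start with one sign, so the value is its own negative.\<close>
  have base: "X i 0 k l = 0" if "i + k + l = n" for i k l
  proof -
    have "X i 0 (k + l) 0 = - X 0 (k + l) 0 i"
      using A[of i 0 "k + l" 0] that by simp
    also have "X 0 (k + l) 0 i = X 0 i 0 (k + l)"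
      using S[of 0 "k + l" 0 i] that by simp
    also have "\<dots> = X i 0 0 (k + l)"
      using T[of i 0 "k + l"] that by simp
    also have "\<dots> = X i 0 (k + l) 0"
      using shift[of i 0 "k + l"] that by simp
    finally have "X i 0 (k + l) 0 = 0" by simp
    then show ?thesis using shift[OF that] by simp
  qed
  show ?thesis
    using n
  proof (induction j arbitrary: i k l)
    case (Suc j)
    then show ?case
      using XY[of i j k l] Suc.IH[of "Suc i" k l] Suc.IH[of i "Suc k" l] Suc.IH[of i k "Suc l"]
      by (simp add: Y_def)
  qed (simp add: base)
qed

section \<open>Vanishing on words with two chords\<close>

abbreviation legs :: "nat \<Rightarrow> nat list" where
  "legs i \<equiv> replicate i 0"

text \<open>A cyclic word is cut just behind the end of a chord, so four arcs remain. Here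
  \<open>j\<close> and \<open>l\<close> count the legs cut off by the chords \<open>b\<close> and
  \<open>c\<close>, while \<open>i\<close> and \<open>k\<close> belong to the arcs between the
  chords.\<close>

definition word_parallel :: "nat \<Rightarrow> nat \<Rightarrow> nat \<Rightarrow> nat \<Rightarrow> nat \<Rightarrow> nat \<Rightarrow> nat list" where
  "word_parallel b c i j k l = legs i @ b # legs j @ b # legs k @ c # legs l @ [c]"

definition word_crossed :: "nat \<Rightarrow> nat \<Rightarrow> nat \<Rightarrow> nat \<Rightarrow> nat \<Rightarrow> nat \<Rightarrow> nat list" where
  "word_crossed b c i j k l = legs i @ b # legs j @ c # legs k @ b # legs l @ [c]"

lemmas word_defs = word_parallel_def word_crossed_def

lemma replicate_mset_add: "replicate_mset (m + n) x = replicate_mset m x + replicate_mset n x"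
  by (rule multiset_eqI) simp

context weight_system
begin

context
  fixes b c n :: nat
  assumes bc: "b \<noteq> 0" "c \<noteq> 0" and n: "odd n"
    and coded: "\<And>w. mset w = replicate_mset n 0 + {#b, b, c, c#} \<Longrightarrow> \<exists>D. codes D w"
begin

section \<open>Values for an odd number of legs and two chords\<close>

lemma V_rev_word:
  assumes "mset w = replicate_mset n 0 + {#b, b, c, c#}"
  shows "V (rev w) = - V w"
proof -
  have "size (mset w) = n + 4" unfolding assms by simp
  then have "length w = n + 4" by simp
  then show ?thesis
    using V_rev[OF coded[OF assms]] n by simp
qed

lemma mset_word:
  assumes "i + j + k + l = n"
  shows "mset (word_parallel b c i j k l) = replicate_mset n 0 + {#b, b, c, c#}"
    "mset (word_crossed b c i j k l) = replicate_mset n 0 + {#b, b, c, c#}"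
  unfolding assms[symmetric] by (simp_all add: word_defs replicate_mset_add add_ac)

lemma parallel_rev:
  assumes "i + j + k + l = n"
  shows "V (word_parallel b c i j k l) = - V (word_parallel b c k j i l)"
  using V_rev_word[OF mset_word(1)[OF assms]]
    V_rotate[of "c # legs l @ [c]" "legs k @ b # legs j @ b # legs i"]
  by (simp add: word_defs)

lemma crossed_rev:
  assumes "i + j + k + l = n"
  shows "V (word_crossed b c i j k l) = - V (word_crossed b c l k j i)"
  using V_rev_word[OF mset_word(2)[OF assms]]
    V_rotate[of "[c]" "legs l @ b # legs k @ c # legs j @ b # legs i"]
  by (simp add: word_defs)

lemma crossed_rotate:
  "V (word_crossed b c i j k l) = V (word_crossed b c k l i j)"
  using V_rotate[of "legs i @ b # legs j @ [c]" "legs k @ b # legs l @ [c]"]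
  by (simp add: word_defs)

text \<open>Of the four terms for a leg and the chord \<open>b\<close>, two put the leg on the inner
  arc \<open>j\<close> and cancel. What remains lets a leg jump across the whole chord.\<close>

lemma parallel_slide:
  assumes "Suc (i + j + k + l) = n"
  shows "V (word_parallel b c (Suc i) j k l) = V (word_parallel b c i j (Suc k) l)"
proof -
  let ?v = "legs k @ c # legs l @ c # legs i"
  have "V (b # 0 # legs j @ b # ?v) - V (0 # b # legs j @ b # ?v) =
      V (0 # b # ?v @ b # legs j) - V (b # 0 # ?v @ b # legs j)"
  proof (rule V_four_term[OF coded bc(1)])
    show "mset (0 # b # legs j @ b # ?v) = replicate_mset n 0 + {#b, b, c, c#}"
      unfolding assms[symmetric] by (simp add: replicate_mset_add add_ac)
  qed
  moreover have "V (b # 0 # legs j @ b # ?v) = V (word_parallel b c i (Suc j) k l)"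
    using V_rotate[of "legs i" "b # 0 # legs j @ b # legs k @ c # legs l @ [c]"]
    by (simp add: word_defs)
  moreover have "V (0 # b # legs j @ b # ?v) = V (word_parallel b c (Suc i) j k l)"
    using V_rotate[of "legs i" "0 # b # legs j @ b # legs k @ c # legs l @ [c]"]
    by (simp add: word_defs replicate_app_Cons_same)
  moreover have "V (0 # b # ?v @ b # legs j) = V (word_parallel b c i (Suc j) k l)"
    using V_rotate[of "legs i @ b # legs j" "0 # b # legs k @ c # legs l @ [c]"]
    by (simp add: word_defs replicate_app_Cons_same)
  moreover have "V (b # 0 # ?v @ b # legs j) = V (word_parallel b c i j (Suc k) l)"
    using V_rotate[of "legs i @ b # legs j" "b # 0 # legs k @ c # legs l @ [c]"]
    by (simp add: word_defs)
  ultimately show ?thesis by simp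
qed

text \<open>By \<open>parallel_slide\<close> the value depends on \<open>i\<close> and
  \<open>k\<close> only through their sum, while reversal exchanges them with a sign.\<close>

lemma V_parallel:
  assumes "i + j + k + l = n"
  shows "V (word_parallel b c i j k l) = 0"
proof -
  have *: "V (word_parallel b c i j k l) = V (word_parallel b c 0 j (i + k) l)"
    if "i + j + k + l = n" for i j k l
    using that
  proof (induction i arbitrary: k)
    case (Suc i)
    then show ?case
      using parallel_slide[of i j k l] Suc.IH[of "Suc k"] by simp
  qed simp
  show ?thesis
    using *[OF assms] *[of k j i l] parallel_rev[OF assms] assms by (simp add: add_ac)
qed

text \<open>4T for a leg passing the ends of \<open>b\<close>: one end separates the arcs
  \<open>i\<close> and \<open>j\<close>, the other one \<open>k\<close> and
  \<open>l\<close>.\<close>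

lemma crossed_slide:
  assumes "Suc (i + j + k + l) = n"
  shows "V (word_crossed b c (Suc i) j k l) - V (word_crossed b c i (Suc j) k l) +
    V (word_crossed b c i j (Suc k) l) - V (word_crossed b c i j k (Suc l)) = 0"
proof -
  let ?u = "legs j @ c # legs k" and ?v = "legs l @ c # legs i"
  have "V (b # 0 # ?u @ b # ?v) - V (0 # b # ?u @ b # ?v) =
      V (0 # b # ?v @ b # ?u) - V (b # 0 # ?v @ b # ?u)"
  proof (rule V_four_term[OF coded bc(1)])
    show "mset (0 # b # ?u @ b # ?v) = replicate_mset n 0 + {#b, b, c, c#}"
      unfolding assms[symmetric] by (simp add: replicate_mset_add add_ac)
  qed
  moreover have "V (b # 0 # ?u @ b # ?v) = V (word_crossed b c i (Suc j) k l)"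
    using V_rotate[of "legs i" "b # 0 # legs j @ c # legs k @ b # legs l @ [c]"]
    by (simp add: word_defs)
  moreover have "V (0 # b # ?u @ b # ?v) = V (word_crossed b c (Suc i) j k l)"
    using V_rotate[of "legs i" "0 # b # legs j @ c # legs k @ b # legs l @ [c]"]
    by (simp add: word_defs replicate_app_Cons_same)
  moreover have "V (0 # b # ?v @ b # ?u) = V (word_crossed b c i j (Suc k) l)"
    using V_rotate[of "legs i @ b # legs j @ c # legs k" "0 # b # legs l @ [c]"]
    by (simp add: word_defs replicate_app_Cons_same)
  moreover have "V (b # 0 # ?v @ b # ?u) = V (word_crossed b c i j k (Suc l))"
    using V_rotate[of "legs i @ b # legs j @ c # legs k" "b # 0 # legs l @ [c]"]
    by (simp add: word_defs)
  ultimately show ?thesis by simp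
qed

text \<open>Moving one end of the first chord past both ends of the second one makes the two chords
  parallel at the intermediate positions.\<close>

lemma crossed_swap:
  assumes "i + k + l = n"
  shows "V (word_crossed b c i 0 k l) = V (word_crossed b c 0 i k l)"
proof -
  let ?u = "legs k @ b # legs l" and ?v = "legs i"
  have "V (c # b # ?u @ c # ?v) - V (b # c # ?u @ c # ?v) =
      V (b # c # ?v @ c # ?u) - V (c # b # ?v @ c # ?u)"
  proof (rule V_four_term[OF coded bc(2)])
    show "mset (b # c # ?u @ c # ?v) = replicate_mset n 0 + {#b, b, c, c#}"
      unfolding assms[symmetric] by (simp add: replicate_mset_add add_ac)
  qed
  moreover have "V (c # b # ?u @ c # ?v) = V (word_parallel b c 0 k l i)"
    using V_rotate[of "[c]" "b # legs k @ b # legs l @ c # legs i"]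
    by (simp add: word_defs)
  moreover have "V (b # c # ?u @ c # ?v) = V (word_crossed b c i 0 k l)"
    using V_rotate[of "legs i" "b # c # legs k @ b # legs l @ [c]"]
    by (simp add: word_defs)
  moreover have "V (b # c # ?v @ c # ?u) = V (word_parallel b c k l 0 i)"
    using V_rotate[of "legs k @ b # legs l" "b # c # legs i @ [c]"]
    by (simp add: word_defs)
  moreover have "V (c # b # ?v @ c # ?u) = V (word_crossed b c 0 i k l)"
    using V_rotate[of "[c]" "b # legs i @ c # legs k @ b # legs l"]
    by (simp add: word_defs)
  ultimately show ?thesis
    using V_parallel[of 0 k l i] V_parallel[of k l 0 i] assms by simp
qed

lemma V_crossed:
  assumes "i + j + k + l = n"
  shows "V (word_crossed b c i j k l) = 0"
proof (rule four_parameter_vanish[where X = "\<lambda>i j k l. V (word_crossed b c i j k l)" and n = n])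
  show "V (word_crossed b c (Suc i) j k l) - V (word_crossed b c i (Suc j) k l) +
      V (word_crossed b c i j (Suc k) l) - V (word_crossed b c i j k (Suc l)) = 0"
    if "Suc (i + j + k + l) = n" for i j k l
    using that by (rule crossed_slide)
  show "V (word_crossed b c i 0 k l) = V (word_crossed b c 0 i k l)" if "i + k + l = n" for i k l
    using that by (rule crossed_swap)
  show "V (word_crossed b c i j k l) = - V (word_crossed b c l k j i)" if "i + j + k + l = n" for i j k l
    using that by (rule crossed_rev)
qed (rule crossed_rotate assms)+

end

lemma nonzero_letters_Cons:
  assumes "filter (\<lambda>x. x \<noteq> (0::nat)) w = x # xs"
  obtains i v where "w = legs i @ x # v" "filter (\<lambda>x. x \<noteq> 0) v = xs" "x \<noteq> 0"
proof -
  obtain u v where uv: "w = u @ x # v" "\<forall>y\<in>set u. \<not> y \<noteq> 0" "x \<noteq> 0" "xs = filter (\<lambda>x. x \<noteq> 0) v"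
    using assms by (auto simp: filter_eq_Cons_iff)
  then have "u = legs (length u)"
    by (metis replicate_length_same)
  then show ?thesis using that uv by metis
qed

text \<open>Up to rotation and exchange of the two letters, the chord ends read
  \<open>b b c c\<close> or \<open>b c b c\<close>. The vanishing results are therefore taken for
  both orders of the letters.\<close>

lemma V_word:
  assumes bc: "b \<noteq> 0" "c \<noteq> 0" "b \<noteq> c" and n: "odd n"
    and w: "codes D w" "mset w = replicate_mset n 0 + {#b, b, c, c#}"
  shows "W D = 0"
proof -
  have coded: "\<exists>D. codes D w'" if "mset w' = replicate_mset n 0 + {#b, b, c, c#}" for w'
    using codes_mset[of "[]" w w'] w that by auto
  have coded': "\<exists>D. codes D w'" if "mset w' = replicate_mset n 0 + {#c, c, b, b#}" for w'
    using coded that by (simp add: add_mset_commute)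
  note vanish = V_parallel[OF bc(1,2) n coded] V_crossed[OF bc(1,2) n coded]
    V_parallel[OF bc(2,1) n coded'] V_crossed[OF bc(2,1) n coded']
  define ls where "ls = filter (\<lambda>x. x \<noteq> 0) w"
  have ms: "mset ls = {#b, b, c, c#}"
    using bc by (simp add: ls_def mset_filter w(2))
  then have "size (mset ls) = 4" by simp
  then have "length ls = 4" by simp
  then obtain x1 x2 x3 x4 where ls: "ls = [x1, x2, x3, x4]"
    by (auto simp: numeral_eq_Suc length_Suc_conv)
  have "set_mset (mset ls) = {b, c}" "count (mset ls) b = 2"
    unfolding ms using bc(3) by auto
  then have "(x1 = b \<or> x1 = c) \<and> (x2 = b \<or> x2 = c) \<and> (x3 = b \<or> x3 = c) \<and> (x4 = b \<or> x4 = c)"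
      "count (mset ls) b = 2"
    unfolding ls by auto
  then have perm: "[x1, x2, x3, x4] \<in>
      {[b, b, c, c], [b, c, b, c], [b, c, c, b], [c, b, b, c], [c, b, c, b], [c, c, b, b]}"
    unfolding ls using bc(3) by (elim conjE disjE) simp_all
  obtain i w1 where w1: "w = legs i @ x1 # w1" "filter (\<lambda>x. x \<noteq> 0) w1 = [x2, x3, x4]"
    using nonzero_letters_Cons[of w] ls by (metis ls_def)
  obtain j w2 where w2: "w1 = legs j @ x2 # w2" "filter (\<lambda>x. x \<noteq> 0) w2 = [x3, x4]"
    using nonzero_letters_Cons[OF w1(2)] .
  obtain k w3 where w3: "w2 = legs k @ x3 # w3" "filter (\<lambda>x. x \<noteq> 0) w3 = [x4]"
    using nonzero_letters_Cons[OF w2(2)] .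
  obtain l w4 where w4: "w3 = legs l @ x4 # w4" "filter (\<lambda>x. x \<noteq> 0) w4 = []"
    using nonzero_letters_Cons[OF w3(2)] .
  obtain m where m: "w4 = legs m"
    using w4(2) by (metis (mono_tags, lifting) filter_empty_conv replicate_length_same)
  have weq: "w = legs i @ x1 # legs j @ x2 # legs k @ x3 # legs l @ x4 # legs m"
    using w1 w2 w3 w4 m by simp
  have x: "x1 \<noteq> 0" "x2 \<noteq> 0" "x3 \<noteq> 0" "x4 \<noteq> 0"
    using arg_cong[OF ls, of set] by (auto simp: ls_def)
  have sum: "(m + i) + j + k + l = n"
  proof -
    have "count (mset w) 0 = i + j + k + l + m" using x by (simp add: weq)
    moreover have "count (mset w) 0 = n" using bc by (simp add: w(2))
    ultimately show ?thesis by simp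
  qed
  \<comment> \<open>The trailing legs join the first arc of the cyclic word.\<close>
  have rot: "V w = V (legs (m + i) @ x1 # legs j @ x2 # legs k @ x3 # legs l @ [x4])"
    using V_rotate[of "legs i @ x1 # legs j @ x2 # legs k @ x3 # legs l @ [x4]" "legs m"]
    by (simp add: weq replicate_add)
  \<comment> \<open>For the patterns \<open>b c c b\<close> and \<open>c b b c\<close>, rotating one
    more letter to the end makes equal letters adjacent.\<close>
  have rot3: "V w = V (legs j @ x2 # legs k @ x3 # legs l @ x4 # legs (m + i) @ [x1])"
    using rot V_rotate[of "legs (m + i) @ [x1]" "legs j @ x2 # legs k @ x3 # legs l @ [x4]"] by simp
  have "V w = 0"
    using perm vanish(1)[of "m + i" j k l] vanish(2)[of "m + i" j k l] vanish(3)[of "m + i" j k l]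
      vanish(4)[of "m + i" j k l] vanish(1)[of j k l "m + i"] vanish(3)[of j k l "m + i"] sum rot rot3
    by (auto simp: word_defs add_ac)
  then show ?thesis using V_eq[OF w(1)] by simp
qed

end

section \<open>Reduction to circles through all trivalent vertices\<close>

lemma rots_disjoint:
  assumes "distinct (verts D xs)" "x \<in> set xs"
  shows "rot D x \<notin> set xs"
proof -
  have "distinct (verts D xs) \<Longrightarrow> set xs \<inter> rot D ` set xs = {}"
    by (induction xs) (auto simp: set_verts_split)
  then show ?thesis using assms by blast
qed

lemma length_bound:
  assumes "pre_jacobi D" "distinct (verts D xs)"
  shows "length xs \<le> card (half_edges D)"
proof -
  have "card (set (verts D xs)) \<le> card (half_edges D)"
    using assms distinct_verts_trivalent(2)[OF assms] by (intro card_mono) (auto simp: pre_jacobi_def)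
  then show ?thesis
    using distinct_card[OF assms(2)] by simp
qed

context weight_system
begin

text \<open>Of the \<open>u + 4\<close> half-edges pointing off the circle, \<open>u\<close> lead to
  leg ends; \<open>opp D\<close> pairs the other four into two chords, which get the letters 1 and
  2.\<close>

lemma W_full_circle:
  assumes D: "good D" and circ: "circle D xs" and full: "full D xs" and odd: "odd (card (leg_ends D))"
  shows "W D = 0"
proof -
  have pj: "pre_jacobi D" using D by (simp add: good_def)
  define ts where "ts = thirds D xs"
  have dist: "distinct ts" using circle_distinct[OF circ] by (simp add: ts_def)
  have tH: "t \<in> half_edges D" "rot D t \<noteq> t" if "t \<in> set ts" for t
    using that set_thirds_subset[of D xs] circle_trivalent[OF pj circ] by (auto simp: ts_def)
  have oo: "opp D (opp D t) = t" "opp D t \<noteq> t" if "t \<in> set ts" for t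
    using pre_jacobiD[OF pj tH(1)[OF that]] by simp_all
  define A where "A = opp D ` leg_ends D"
  define C where "C = {t \<in> set ts. opp D t \<in> set ts}"
  have leg: "opp D h \<in> set ts" "opp D (opp D h) = h" if "h \<in> leg_ends D" for h
    using opp_third(2)[OF D circ full that] pre_jacobiD(4)[OF pj] that by (auto simp: ts_def leg_ends_def)
  have nleg: "t \<notin> leg_ends D" if "t \<in> set ts" for t
    using tH(2)[OF that] by (simp add: leg_ends_def)
  have AC: "set ts = A \<union> C" "A \<inter> C = {}"
  proof -
    have "t \<in> A" if "t \<in> set ts" "opp D t \<in> leg_ends D" for t
      using oo(1)[OF that(1)] that(2) unfolding A_def by (metis imageI)
    then show "set ts = A \<union> C"
      using opp_third(1)[OF D circ full] leg(1) by (auto simp: C_def A_def ts_def[symmetric])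
    show "A \<inter> C = {}"
      using leg(2) nleg by (auto simp: A_def C_def)
  qed
  have cardA: "card A = card (leg_ends D)"
    unfolding A_def using pre_jacobi_inj(2)[OF pj] by (intro card_image inj_onI) simp
  have fin: "finite A" "finite C" using AC(1) by (metis finite_Un finite_set)+
  have "card (set ts) = card A + card C"
    unfolding AC(1) using fin AC(2) by (rule card_Un_disjoint)
  then have "card C = 4"
    using card_full(2)[OF D circ full] distinct_card[OF dist] cardA by (simp add: ts_def)
  then obtain t where t: "t \<in> C" by fastforce
  define t' where "t' = opp D t"
  have C_opp: "opp D s \<in> C" "opp D s \<noteq> s" "opp D (opp D s) = s" if "s \<in> C" for s
    using that oo by (auto simp: C_def)
  have "card {t, t'} \<le> 2" by (simp add: card_insert_if)
  then have "\<not> C \<subseteq> {t, t'}"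
    using card_mono[of "{t, t'}" C] \<open>card C = 4\<close> by auto
  then obtain s where s: "s \<in> C" "s \<noteq> t" "s \<noteq> t'" by blast
  define s' where "s' = opp D s"
  have s': "s' \<noteq> t" "s' \<noteq> t'" "s' \<noteq> s" "s' \<in> C" "opp D s' = s" "opp D s = s'"
    using C_opp[OF s(1)] C_opp[OF t] s pre_jacobi_inj(2)[OF pj] by (auto simp: s'_def t'_def)
  have t': "t' \<noteq> t" "t' \<in> C" "opp D t' = t" "opp D t = t'"
    using C_opp[OF t] by (auto simp: t'_def)
  have "card {t, t', s, s'} = 4" using s s' t' by auto
  moreover have "{t, t', s, s'} \<subseteq> C"
    using t t'(2) s(1) s'(4) by simp
  ultimately have C: "C = {t, t', s, s'}"
    using card_subset_eq[OF fin(2)] \<open>card C = 4\<close> by metis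
  define L where "L h = (if h \<in> {t, t'} then 1 else if h \<in> {s, s'} then 2 else (0::nat))" for h
  have L: "L t = 1" "L t' = 1" "L s = 2" "L s' = 2" "\<And>h. h \<notin> C \<Longrightarrow> L h = 0"
    using s(2,3) s'(1,2) by (simp_all add: L_def C)
  have "coloring (opp D) ts L"
    unfolding coloring_def
  proof (intro ballI)
    fix h k assume h: "h \<in> set ts" and k: "k \<in> set ts"
    show "opp D h = k \<longleftrightarrow> h \<noteq> k \<and> L h = L k \<and> L h \<noteq> 0"
    proof (cases "h \<in> C")
      case True
      show ?thesis
      proof (cases "k \<in> C")
        case True
        then show ?thesis
          using \<open>h \<in> C\<close> s(2,3) s'(1-3,5,6) t'(1,3,4) L(1-4) unfolding C
            by (elim insertE emptyE) simp_all
      next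
        case False
        then show ?thesis using C_opp(1)[OF \<open>h \<in> C\<close>] L(5) by auto
      qed
    next
      case False
      then show ?thesis using h k L(5) by (auto simp: C_def)
    qed
  qed
  then have codes: "codes D (map L ts)"
    using D circ full unfolding codes_def ts_def by blast
  have "mset (map L ts) = image_mset L (mset_set (A \<union> C))"
    by (simp add: mset_set_set[OF dist, symmetric] AC(1)[symmetric])
  also have "\<dots> = image_mset L (mset_set A) + image_mset L (mset_set C)"
    using fin AC(2) by (simp add: mset_set_Union)
  also have "image_mset L (mset_set A) = image_mset (\<lambda>_. 0) (mset_set A)"
    using AC(2) L(5) fin by (intro image_mset_cong) auto
  also have "\<dots> = replicate_mset (card (leg_ends D)) 0"
    by (simp add: image_mset_const_eq cardA)
  also have "image_mset L (mset_set C) = {#1, 1, 2, 2#}"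
    unfolding C using s(2,3) s'(1-3) t'(1) L(1-4) by simp
  finally have "mset (map L ts) = replicate_mset (card (leg_ends D)) 0 + {#1, 1, 2, 2#}" .
  then show ?thesis
    using V_word[of 1 2, OF _ _ _ odd codes] by simp
qed

text \<open>Each expansion puts one more trivalent vertex on the circle, and connectedness supplies
  such a vertex as long as the circle is not full. The number of half-edges bounds the
  length.\<close>

lemma W_circle:
  assumes "good D" "circle D xs" "odd (card (leg_ends D))"
  shows "W D = 0"
  using assms
proof (induction "card (half_edges D) - length xs" arbitrary: D xs rule: less_induct)
  case less
  note D = less.prems(1) and circ = less.prems(2) and odd = less.prems(3)
  have pj: "pre_jacobi D" and cc: "closed_connected D" using D by (simp_all add: good_def)
  show ?case
  proof (cases "full D xs")
    case True
    then show ?thesis using W_full_circle D circ odd by blast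
  next
    case False
    let ?K = "set (verts D xs)"
    have ex: "\<exists>x\<in>set xs. opp D (rot D (rot D x)) \<notin> ?K \<and> rot D (opp D (rot D (rot D x))) \<noteq> opp D (rot D (rot D x))"
    proof (rule ccontr)
      assume neg: "\<not> ?thesis"
      \<comment> \<open>If no vertex could be absorbed, the circle together with the legs attached
        to it would be stable, hence everything.\<close>
      define S where "S = ?K \<union> {h \<in> leg_ends D. opp D h \<in> ?K}"
      have KH: "?K \<subseteq> half_edges D"
        using circle_trivalent(2)[OF pj circ] by blast
      have "opp D h \<in> S \<and> rot D h \<in> S" if "h \<in> S" for h
      proof (cases "h \<in> ?K")
        case True
        then have oo: "opp D (opp D h) = h" "opp D h \<in> half_edges D"
          using KH pre_jacobiD[OF pj] by auto
        have "opp D h \<in> S"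
        proof (cases "h \<in> set (thirds D xs)")
          case True
          then show ?thesis
            using neg oo \<open>h \<in> ?K\<close> by (auto simp: thirds_def S_def leg_ends_def)
        next
          case False
          then have "h \<in> set xs \<or> h \<in> rot D ` set xs"
            using \<open>h \<in> ?K\<close> by (simp add: set_verts_split)
          then show ?thesis
            using circle_opp_closed[OF pj circ] by (auto simp: S_def set_verts_split)
        qed
        then show ?thesis
          using True rot_in_verts_iff[OF pj] by (simp add: S_def)
      next
        case False
        then show ?thesis using that by (auto simp: S_def leg_ends_def)
      qed
      moreover have "S \<subseteq> half_edges D" using KH by (auto simp: S_def leg_ends_def)
      moreover have "S \<noteq> {}" using circ by (cases xs) (auto simp: S_def circle_def)
      ultimately have "S = half_edges D"
        using cc unfolding closed_connected_def by blast
      then show False using False by (auto simp: full_def S_def)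
    qed
    then obtain x where x: "x \<in> set xs" "opp D (rot D (rot D x)) \<notin> ?K"
      "rot D (opp D (rot D (rot D x))) \<noteq> opp D (rot D (rot D x))" by blast
    then obtain us vs where xs: "xs = us @ x # vs" by (meson split_list)
    have circ': "circle D (x # vs @ us)"
      using circle_rotate[of D us "x # vs"] circ by (simp add: xs)
    have notin: "opp D (rot D (rot D x)) \<notin> set (verts D (x # vs @ us))"
      using x(2) by (auto simp: xs)
    obtain D1 D2 y1 y2 where E: "W D = W D1 - W D2"
      "good D1" "half_edges D1 = half_edges D" "opp D1 = opp D" "leg_ends D1 = leg_ends D"
      "circle D1 (x # y1 # vs @ us)" 
      "thirds D1 (x # y1 # vs @ us) = rot D (rot D (opp D (rot D (rot D x)))) # rot D (opp D (rot D (rot D x))) # thirds D (vs @ us)"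
      "set (verts D1 (x # y1 # vs @ us)) = {opp D (rot D (rot D x)), rot D (opp D (rot D (rot D x))), rot D (rot D (opp D (rot D (rot D x))))} \<union> set (verts D (x # vs @ us))"
      "good D2" "half_edges D2 = half_edges D" "opp D2 = opp D" "leg_ends D2 = leg_ends D"
      "circle D2 (x # y2 # vs @ us)" 
      "thirds D2 (x # y2 # vs @ us) = rot D (opp D (rot D (rot D x))) # rot D (rot D (opp D (rot D (rot D x)))) # thirds D (vs @ us)"
      "set (verts D2 (x # y2 # vs @ us)) = {opp D (rot D (rot D x)), rot D (opp D (rot D (rot D x))), rot D (rot D (opp D (rot D (rot D x))))} \<union> set (verts D (x # vs @ us))"
      using expand[OF D circ' refl notin x(3)] .
    have "length (x # y1 # vs @ us) \<le> card (half_edges D)"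
      using length_bound[of D1 "x # y1 # vs @ us"] E(2,3,6) by (simp add: good_def circle_def)
    then have len: "card (half_edges D) - length (x # y # vs @ us) < card (half_edges D) - length xs" for y
      by (simp add: xs)
    have "W D1 = 0" "W D2 = 0"
      using less.hyps[OF _ E(2,6)] less.hyps[OF _ E(9,13)] len E odd by simp_all
    then show ?thesis using E(1) by simp
  qed
qed

text \<open>Exchanging the two legs is an isomorphism onto the diagram with the opposite orientation
  at the vertex.\<close>

lemma W_cherry:
  assumes D: "good D" and x: "rot D x \<noteq> x"
    and legs: "opp D (rot D x) \<in> leg_ends D" "opp D (rot D (rot D x)) \<in> leg_ends D"
  shows "W D = 0"
proof -
  have pj: "pre_jacobi D" using D by (simp add: good_def)
  define r s where "r = rot D x" and "s = rot D r"
  have rs: "rot D x = r" "rot D r = s" "rot D s = x"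
    using pre_jacobi_cube[OF pj, of x] by (simp_all add: r_def s_def)
  define r' s' where "r' = opp D r" and "s' = opp D s"
  have H: "r \<in> half_edges D" "s \<in> half_edges D" "x \<in> half_edges D"
    using pre_jacobi_trivalent[OF pj x] pre_jacobiD(2)[OF pj] by (simp_all add: r_def s_def)
  have ne: "r \<noteq> x" "s \<noteq> x" "s \<noteq> r"
    using x pre_jacobi_distinct[OF pj x] by (auto simp: r_def s_def)
  have op: "opp D r = r'" "opp D r' = r" "opp D s = s'" "opp D s' = s"
    using pre_jacobiD(4)[OF pj] H by (simp_all add: r'_def s'_def)
  have lg: "rot D r' = r'" "rot D s' = s'" "r' \<in> half_edges D" "s' \<in> half_edges D"
    using legs by (simp_all add: leg_ends_def r'_def s'_def r_def s_def)
  have ne': "r' \<noteq> s'" "r' \<noteq> x" "r' \<noteq> r" "r' \<noteq> s" "s' \<noteq> x" "s' \<noteq> r" "s' \<noteq> s"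
    using op lg rs ne by metis+
  define D' where "D' = flip {x, r, s} D"
  have D': "good D'"
    unfolding D'_def using H rs by (intro good_flip[OF D]) auto
  define f where "f h = (if h = r then s else if h = s then r else if h = r' then s' else if h = s' then r' else h)" for h
  have f: "f r = s" "f s = r" "f r' = s'" "f s' = r'" "f x = x" 
    "\<And>h. h \<noteq> r \<Longrightarrow> h \<noteq> s \<Longrightarrow> h \<noteq> r' \<Longrightarrow> h \<noteq> s' \<Longrightarrow> f h = h"
    using ne ne' by (auto simp: f_def)
  have ff: "f (f h) = h" for h
    using ne ne' by (simp add: f_def)
  have fH: "f h \<in> half_edges D" if "h \<in> half_edges D" for h
    using that H lg by (simp add: f_def)
  have bij: "bij_betw f (half_edges D) (half_edges D')"
    by (rule bij_betw_byWitness[of _ f]) (use ff fH in \<open>auto simp: D'_def\<close>)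
  have comm: "f (opp D h) = opp D' (f h) \<and> f (rot D h) = rot D' (f h)" if "h \<in> half_edges D" for h
  proof -
    have out: "opp D h \<notin> {r, s, r', s'} \<and> rot D h \<notin> {x, r, s, r', s'}"
      if "h \<notin> {x, r, s, r', s'}"
    proof -
      have "opp D h \<notin> {r, s, r', s'}"
        using that pre_jacobi_inj(2)[OF pj, of h r'] pre_jacobi_inj(2)[OF pj, of h r]
          pre_jacobi_inj(2)[OF pj, of h s'] pre_jacobi_inj(2)[OF pj, of h s] unfolding op by blast
      moreover have "rot D h \<notin> {x, r, s, r', s'}"
        using that pre_jacobi_inj(1)[OF pj, of h x] pre_jacobi_inj(1)[OF pj, of h r]
          pre_jacobi_inj(1)[OF pj, of h s] pre_jacobi_inj(1)[OF pj, of h r']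
          pre_jacobi_inj(1)[OF pj, of h s'] unfolding rs lg by blast
      ultimately show ?thesis by blast
    qed
    consider "h = x" | "h = r" | "h = s" | "h = r'" | "h = s'" | "h \<notin> {x, r, s, r', s'}" by blast
    then show ?thesis
    proof cases
      case 1
      have "opp D x \<notin> {r, s, r', s'}"
        using ne ne' pre_jacobi_inj(2)[OF pj, of x r'] pre_jacobi_inj(2)[OF pj, of x r]
          pre_jacobi_inj(2)[OF pj, of x s'] pre_jacobi_inj(2)[OF pj, of x s] unfolding op by blast
      then show ?thesis using 1 f rs ne ne' by (simp add: D'_def)
    next
      case 6
      then show ?thesis using out f by (simp add: D'_def)
    qed (use f op lg rs ne ne' in \<open>simp_all add: D'_def\<close>)
  qed
  have "jacobi_iso D D'"
    unfolding jacobi_iso_def jacobi_iff_pre_jacobi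
  proof (intro conjI exI ballI)
    show "pre_jacobi D'" using D' by (simp add: good_def)
    show "f (opp D h) = opp D' (f h)" "f (rot D h) = rot D' (f h)" if "h \<in> half_edges D" for h
      using comm[OF that] by simp_all
  qed (rule pj bij)+
  then have "W D = W D'" by (rule iso)
  also have "W D' = - W D"
    unfolding D'_def using W_flip_vertex[OF D x] rs by simp
  finally show ?thesis by simp
qed

lemma linked_flip:
  assumes "linked D xs" "\<And>x. x \<in> set (butlast xs) \<Longrightarrow> x \<notin> K"
  shows "linked (flip K D) xs"
  using assms by (induction xs rule: induct_list012) auto

text \<open>A path cannot be prolonged forever: the vertex after its last one is already on it, which closes
  a circle, unless the last vertex carries two legs.\<close>

lemma W_path_step:
  assumes D: "good D" and odd: "odd (card (leg_ends D))"
    and dist: "distinct (verts D (us @ [l]))" and lnk: "linked D (us @ [l])"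
    and tri: "rot D (opp D (rot D l)) \<noteq> opp D (rot D l)"
    and longer: "opp D (rot D l) \<notin> set (verts D (us @ [l])) \<Longrightarrow> W D = 0"
  shows "W D = 0"
proof (cases "opp D (rot D l) \<in> set (verts D (us @ [l]))")
  case True
  have pj: "pre_jacobi D" using D by (simp add: good_def)
  define z where "z = opp D (rot D l)"
  have lH: "rot D l \<in> half_edges D"
    using distinct_verts_trivalent(2)[OF pj dist, of "rot D l"] by simp
  have oz: "opp D z = rot D l" "z \<noteq> rot D l"
    using pre_jacobiD[OF pj lH] by (simp_all add: z_def)
  obtain x where x: "x \<in> set (us @ [l])" "z \<in> {x, rot D x, rot D (rot D x)}"
    using True by (auto simp: set_verts z_def)
  then obtain ps vs where split: "us @ [l] = ps @ x # vs" by (meson split_list)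
  have dist': "distinct (verts D (x # vs))" and lnk': "linked D (x # vs)"
    using dist lnk linked_append[of D ps x vs] unfolding split by simp_all
  have last: "last (x # vs) = l"
    using arg_cong[OF split, of last] by simp
  consider "z = x" | "z = rot D x" | "z = rot D (rot D x)" using x(2) by blast
  then show ?thesis
  proof cases
    case 1
    have "linked D ((x # vs) @ [x])"
    proof -
      obtain ws where ws: "x # vs = ws @ [l]"
        using last by (metis append_butlast_last_id list.discI)
      show ?thesis
        using lnk' linked_append[of D ws l "[x]"] 1 unfolding ws by (simp add: z_def)
    qed
    then have "circle D (x # vs)"
      using dist' by (simp add: circle_def)
    then show ?thesis using W_circle D odd by blast
  next
    \<comment> \<open>The exit of \<open>x\<close> is already joined to the next entrance on the
      path or, if \<open>x\<close> is the last vertex, would be opposite to itself.\<close>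
    case 2
    show ?thesis
    proof (cases vs)
      case Nil
      then show ?thesis using last 2 oz by simp
    next
      case (Cons v vs')
      then have "opp D z = v" using lnk' 2 by simp
      then have "v = rot D l" using oz by simp
      moreover have "v \<in> set (us @ [l])" unfolding split Cons by simp
      ultimately show ?thesis
        using rots_disjoint[OF dist, of l] by simp
    qed
  next
    \<comment> \<open>The circle enters \<open>x\<close> at its third half-edge and must still leave
      at \<open>rot D x\<close>; reversing the cyclic order at \<open>x\<close> achieves
      this.\<close>
    case 3
    let ?K = "{x, rot D x, rot D (rot D x)}"
    define D' where "D' = flip ?K D"
    have xt: "rot D x \<noteq> x" using dist' by simp
    have cube: "rot D (rot D (rot D x)) = x" using pre_jacobi_cube[OF pj] .
    have D': "good D'" "leg_ends D' = leg_ends D"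
      unfolding D'_def using distinct_verts_trivalent(2)[OF pj dist', of _] cube
      by (auto intro!: good_flip[OF D])
    have K: "?K \<inter> set (verts D vs) = {}" using dist' by auto
    have r': "rot D' z = rot D x" "rot D' (rot D x) = x"
      using cube by (simp_all add: D'_def 3)
    have cg: "verts D' vs = verts D vs"
      using K by (intro verts_cong) (auto simp: D'_def)
    have "linked D' ((z # vs) @ [z])"
    proof (cases "vs = []")
      case True
      then have "opp D (rot D x) = z" using last by (simp add: z_def)
      then show ?thesis using True r' by (simp add: D'_def)
    next
      case False
      then obtain ws where ws: "vs = ws @ [l]"
        using last by (metis append_butlast_last_id last.simps)
      have "linked D (vs @ [z])"
        using lnk' linked_append[of D ws l "[z]"] linked_Cons[OF False] unfolding ws by (simp add: z_def)
      moreover have "x \<notin> ?K" if "x \<in> set vs" for x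
        using that K set_subset_verts[of vs D] by blast
      ultimately have "linked D' (vs @ [z])"
        unfolding D'_def by (intro linked_flip) (auto simp: butlast_append)
      moreover have "opp D' (rot D' z) = hd (vs @ [z])"
        using lnk' False linked_Cons[OF False] r' by (simp add: D'_def)
      ultimately show ?thesis by (simp add: linked_Cons)
    qed
    moreover have "distinct (verts D' (z # vs))"
      using dist' r' by (simp add: cg) (auto simp: 3)
    ultimately have "circle D' (z # vs)" by (simp add: circle_def)
    then have "W D' = 0" using W_circle D' odd by simp
    then show ?thesis using W_flip_vertex[OF D xt] by (simp add: D'_def)
  qed
qed (rule longer)

text \<open>The path may leave its last vertex in either direction, for one of them after an AS
  flip. If both directions end in legs, \<open>W_cherry\<close> applies. Lengths are bounded by the
  number of half-edges, which makes the induction terminate.\<close>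

lemma W_path:
  assumes "good D" "odd (card (leg_ends D))" "distinct (verts D (us @ [l]))" "linked D (us @ [l])"
  shows "W D = 0"
  using assms
proof (induction "card (half_edges D) - length us" arbitrary: D us l rule: less_induct)
  case less
  note D = less.prems(1) and odd = less.prems(2) and dist = less.prems(3) and lnk = less.prems(4)
  have step: "W E = 0" if E: "good E" "leg_ends E = leg_ends D" "half_edges E = half_edges D"
    "distinct (verts E (us @ [l]))" "linked E (us @ [l])" "rot E (opp E (rot E l)) \<noteq> opp E (rot E l)" for E
  proof (rule W_path_step[OF E(1) _ E(4-6)])
    show "odd (card (leg_ends E))" using odd E by simp
    assume z: "opp E (rot E l) \<notin> set (verts E (us @ [l]))"
    have pj: "pre_jacobi E" using E by (simp add: good_def)
    let ?z = "opp E (rot E l)"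
    have "distinct (verts E ((us @ [l]) @ [?z]))"
      using E(4,6) z rot_in_verts_iff[OF pj, of _ "us @ [l]"] pre_jacobi_distinct[OF pj E(6)]
      unfolding verts_simps(3)[of E "us @ [l]"] distinct_append by auto
    moreover have "linked E ((us @ [l]) @ [?z])"
      using E(5) linked_append[of E us l "[?z]"] by simp
    moreover have "length ((us @ [l]) @ [?z]) \<le> card (half_edges E)"
      using length_bound[OF pj] calculation by blast
    ultimately show "W E = 0"
      using less.hyps[of E "us @ [l]" ?z] E(1-3) odd by simp
  qed
  have pj: "pre_jacobi D" using D by (simp add: good_def)
  have lt: "rot D l \<noteq> l" "l \<in> half_edges D"
    using distinct_verts_trivalent[OF pj dist, of l] by simp_all
  then have H: "opp D (rot D l) \<in> half_edges D" "opp D (rot D (rot D l)) \<in> half_edges D"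
    using pre_jacobiD(1,2)[OF pj] by simp_all
  consider "rot D (opp D (rot D l)) \<noteq> opp D (rot D l)"
    | "rot D (opp D (rot D (rot D l))) \<noteq> opp D (rot D (rot D l))"
    | "opp D (rot D l) \<in> leg_ends D" "opp D (rot D (rot D l)) \<in> leg_ends D"
    using H by (auto simp: leg_ends_def)
  then show ?case
  proof cases
    case 1
    then show ?thesis using step[OF D refl refl dist lnk] by simp
  next
    case 2
    let ?K = "{l, rot D l, rot D (rot D l)}"
    define D' where "D' = flip ?K D"
    have cube: "rot D (rot D (rot D l)) = l" using pre_jacobi_cube[OF pj] .
    have D': "good D'" "leg_ends D' = leg_ends D"
      unfolding D'_def using distinct_verts_trivalent(2)[OF pj dist] cube
      by (auto intro!: good_flip[OF D])
    have K: "?K \<inter> set (verts D us) = {}" using dist by auto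
    have cg: "verts D' us = verts D us"
      using K by (intro verts_cong) (auto simp: D'_def)
    have r': "rot D' l = rot D (rot D l)" "rot D' (rot D (rot D l)) = rot D l"
      using cube by (simp_all add: D'_def)
    have "W D' = 0"
    proof (rule step[OF D'])
      show "half_edges D' = half_edges D" by (simp add: D'_def)
      show "distinct (verts D' (us @ [l]))" using dist by (auto simp: cg r')
      have "x \<notin> ?K" if "x \<in> set us" for x
        using that K set_subset_verts[of us D] by blast
      then show "linked D' (us @ [l])"
        unfolding D'_def by (intro linked_flip[OF lnk]) auto
      \<comment> \<open>The new exit may lead back to \<open>l\<close> itself, where the rotation
        has been reversed; the reversed rotation has no fixed point there either.\<close>
      have "opp D (rot D (rot D l)) \<notin> ?K \<or> rot D' (opp D (rot D (rot D l))) \<noteq> opp D (rot D (rot D l))"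
        using pre_jacobi_distinct[OF pj lt(1)] lt(1) cube by (auto simp: D'_def)
      then show "rot D' (opp D' (rot D' l)) \<noteq> opp D' (rot D' l)"
        unfolding r' using 2 by (auto simp: D'_def)
    qed
    then show ?thesis using W_flip_vertex[OF D lt(1)] by (simp add: D'_def)
  next
    case 3
    then show ?thesis by (rule W_cherry[OF D lt(1)])
  qed
qed

text \<open>A single trivalent vertex is a path to start from, and the \<open>4 u + 12\<close>
  half-edges cannot all be leg ends.\<close>

lemma W_odd:
  assumes D: "good D" and odd: "odd (card (leg_ends D))"
  shows "W D = 0"
proof -
  have pj: "pre_jacobi D" using D by (simp add: good_def)
  have "half_edges D \<noteq> leg_ends D"
  proof
    assume "half_edges D = leg_ends D"
    then show False using D by (simp add: good_def)
  qed
  then obtain x where x: "rot D x \<noteq> x" by (auto simp: leg_ends_def)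
  then show ?thesis
    using W_path[OF D odd, of "[]" x] pre_jacobi_distinct[OF pj x] by auto
qed

end

section \<open>The quotient space\<close>

text \<open>Adjoining \<open>x\<close> to a basis of the span keeps it independent, so some linear
  map is 1 at \<open>x\<close> and 0 on that basis.\<close>

lemma exists_functional:
  fixes S :: "('a \<Rightarrow>\<^sub>0 rat) set"
  assumes "x \<notin> chain.span S"
  obtains \<phi> :: "('a \<Rightarrow>\<^sub>0 rat) \<Rightarrow> rat" where "\<And>a b. \<phi> (a + b) = \<phi> a + \<phi> b" "\<And>s. s \<in> S \<Longrightarrow> \<phi> s = 0" "\<phi> x = 1"
proof -
  interpret p: vector_space_pair "chain_scale :: rat \<Rightarrow> ('a \<Rightarrow>\<^sub>0 rat) \<Rightarrow> _" "(*) :: rat \<Rightarrow> rat \<Rightarrow> rat"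
    by unfold_locales (simp_all add: algebra_simps)
  obtain B where B: "B \<subseteq> S" "chain.independent B" "S \<subseteq> chain.span B"
    using chain.maximal_independent_subset[of S] by blast
  have "x \<notin> chain.span B"
    using assms chain.span_mono[OF B(1)] by blast
  then have "chain.independent (insert x B)" "x \<notin> B"
    using B(2) chain.independent_insertI chain.span_base by blast+
  then obtain g where g: "Vector_Spaces.linear chain_scale (*) g" "\<forall>y\<in>insert x B. g y = (if y = x then 1 else 0)"
    using p.linear_independent_extend[of "insert x B" "\<lambda>y. if y = x then 1 else 0"] by blast
  have "g s = 0" if "s \<in> S" for s
  proof (rule p.linear_eq_0_on_span[OF g(1)])
    show "g y = 0" if "y \<in> B" for y using that g(2) \<open>x \<notin> B\<close> by auto
    show "s \<in> chain.span B" using that B(3) by blast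
  qed
  moreover have "g (a + b) = g a + g b" for a b
    using g(1) by (rule p.linear_add)
  ultimately show ?thesis using that g(2) by auto
qed

lemma diagram_iso:
  assumes "jacobi_iso D D'"
  shows "diagram D = diagram D'"
proof -
  have "abs_jacobi_diagram D = abs_jacobi_diagram D'"
    using assms Quotient3_rel_abs[OF Quotient3_jacobi_diagram] by blast
  then show ?thesis by (simp add: diagram_def)
qed

text \<open>A functional separating the diagram from the relators would be a weight system with
  value 1 on it. As the degree is the number of legs plus 2, that number is odd, which contradicts
  \<open>W_odd\<close>.\<close>

lemma odd_diagram_relator:
  assumes "n_loop 3 D" "odd (degree D)"
  shows "diagram D \<in> loop_relators 3"
proof (rule ccontr)
  assume "diagram D \<notin> loop_relators 3"
  then obtain \<phi> :: "(jacobi_diagram \<Rightarrow>\<^sub>0 rat) \<Rightarrow> rat" where \<phi>: "\<And>a b. \<phi> (a + b) = \<phi> a + \<phi> b"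
      "\<phi> (diagram D) = 1"
      "\<And>s. s \<in> {diagram D' + diagram D | D D'. n_loop 3 D \<and> n_loop 3 D' \<and> AS_rel D D'} \<union>
        {diagram D1 + diagram D2 + diagram D3 | D1 D2 D3.
         n_loop 3 D1 \<and> n_loop 3 D2 \<and> n_loop 3 D3 \<and> IHX_rel D1 D2 D3} \<Longrightarrow> \<phi> s = 0"
    unfolding loop_relators_def by (metis (no_types, lifting) exists_functional)
  interpret weight_system "\<lambda>D. \<phi> (diagram D)"
  proof
    fix D D' assume "jacobi_iso D D'"
    then show "\<phi> (diagram D) = \<phi> (diagram D')" by (simp add: diagram_iso)
  next
    fix D D' assume "good D" "good D'" "AS_rel D D'"
    then have "\<phi> (diagram D' + diagram D) = 0"
      by (intro \<phi>(3)) (auto simp: n_loop_3_iff)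
    then show "\<phi> (diagram D') = - \<phi> (diagram D)" by (simp add: \<phi>(1))
  next
    fix D1 D2 D3 assume "good D1" "good D2" "good D3" "IHX_rel D1 D2 D3"
    then have "\<phi> (diagram D1 + diagram D2 + diagram D3) = 0"
      by (intro \<phi>(3)) (auto simp: n_loop_3_iff)
    then show "\<phi> (diagram D1) + \<phi> (diagram D2) + \<phi> (diagram D3) = 0" by (simp add: \<phi>(1))
  qed
  have "good D" using assms(1) by (simp add: n_loop_3_iff)
  then have "\<phi> (diagram D) = 0"
    using assms(2) by (intro W_odd) (simp_all add: degree_good)
  then show False using \<phi>(2) by simp
qed

theorem theorem3p1:
  shows "odd_loop_space 3 = {loop_class 3 0}"
proof -
  have "odd_loop_chains 3 \<subseteq> loop_relators 3"
    unfolding odd_loop_chains_def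
  proof (rule chain.span_minimal)
    show "{diagram D |D. n_loop 3 D \<and> odd (degree D)} \<subseteq> loop_relators 3"
      using odd_diagram_relator by blast
    show "chain.subspace (loop_relators 3)"
      unfolding loop_relators_def by (rule chain.subspace_span)
  qed
  then have "loop_class 3 x = loop_class 3 0" if "x \<in> odd_loop_chains 3" for x
    using that odd_loop_chains_subset[of 3] chain.span_zero unfolding loop_class_def
    by (intro equiv_class_eq[OF equiv_loop_equiv]) (auto simp: loop_equiv_def loop_chains_def)
  moreover have "0 \<in> odd_loop_chains 3"
    unfolding odd_loop_chains_def by (rule chain.span_zero)
  ultimately show ?thesis
    unfolding odd_loop_space_def by blast
qed

end
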